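(* Let $p\in\{2,3\}$, let $D\subset\mathbb{Z}^2$ be a finite digit set with $\emptyset\neq\mathcal{Z}_D^2\subset\mathring{E}_p^2$, and let $M\in M_2(\mathbb{Z})$ be an expanding integer matrix with $\gcd(\det(M),p)=1$. Then $$n^*(\mu_{M,D})=p\ \text{ if } M\in\mathfrak{M}_p^{(1)},\qquad n^*(\mu_{M,D})=p^2\ \text{ if } M\in\mathfrak{M}_p^{(2)}.$$
   Context: A real square matrix is expanding if all its eigenvalues have modulus $>1$. For an expanding matrix $M\in M_2(\mathbb{R})$ and a finite set $D\subset\mathbb{R}^2$ with cardinality $\#(D)$, put $\phi_d(x)=M^{-1}(x+d)$ for $x\in\mathbb{R}^2$, $d\in D$. The self-affine measure $\mu_{M,D}$ is the unique Borel probability measure $\mu$ on $\mathbb{R}^2$ satisfying $\mu=\frac{1}{\#(D)}\sum_{d\in D}\mu\circ\phi_d^{-1}$. For an integer $p\ge2$: $E_p^2:=\frac1p\{(l_1,l_2)^t: l_1,l_2\in\mathbb{Z},\ 0\le l_1,l_2\le p-1\}$ and $\mathring{E}_p^2:=E_p^2\setminus\{0\}$. For a finite $D\subset\mathbb{Z}^2$: $m_D(x)=\frac{1}{\#(D)}\sum_{d\in D}e^{2\pi i\langle d,x\rangle}$ for $x\in\mathbb{R}^2$, and $\mathcal{Z}_D^2:=\{x\in[0,1)^2: m_D(x)=0\}$. For a Borel probability measure $\mu$ with compact support on $\mathbb{R}^2$ and a finite or countable $\Lambda\subset\mathbb{R}^2$, let $\mathcal{E}_\Lambda=\{e^{2\pi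 i\langle\lambda,x\rangle}:\lambda\in\Lambda\}$; it is an orthogonal set if the functions corresponding to any two distinct elements of $\Lambda$ are orthogonal in $L^2(\mu)$. The maximal cardinality of the orthogonal exponential functions in $L^2(\mu)$ is $$n^*(\mu):=\sup\{\#\Lambda:\ \mathcal{E}_\Lambda\text{ is a maximal orthogonal set of exponential functions in }L^2(\mu)\}.$$ Let $\mathfrak{M}_p$ be the class of all expanding matrices $M\in M_2(\mathbb{Z})$ with $\gcd(\det(M),p)=1$, and let $M^*$ denote the conjugate transpose of $M$ (here just the transpose). For the given $D$, $\mathfrak{M}_p$ is divided into the two disjoint subclasses $$\mathfrak{M}_p^{(1)}=\Big\{M\in\mathfrak{M}_p:\ \bigcup_{j=1}^{p^2-1}{M^*}^j\mathcal{Z}_D^2\subsetneqq\mathring{E}_p^2\ (\mathrm{mod}\ \mathbb{Z}^2)\Big\},\quad \mathfrak{M}_p^{(2)}=\Big\{M\in\mathfrak{M}_p:\ \bigcup_{j=1}^{p^2-1}{M^*}^j\mathcal{Z}_D^2=\mathring{E}_p^2\ (\mathrm{mod}\ \mathbb{Z}^2)\Big\}.$$ Relations between sets "mod $\mathbb{Z}^2$" mean relations between their images in $\mathbb{R}^2/\mathbb{Z}^2$. *)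

theory Defs
  imports "HOL-Probability.Probability" "HOL-Library.Extended_Nat"
begin

definition of_int_vec :: "int ^ 'n \<Rightarrow> real ^ 'n" where
  "of_int_vec v = (\<chi> i. of_int (v $ i))"

abbreviation of_int_mat :: "int ^ 'n ^ 'm \<Rightarrow> real ^ 'n ^ 'm" where
  "of_int_mat \<equiv> map_matrix of_int"

text \<open>A real matrix is expanding if all its complex eigenvalues lie outside the closed unit disc.\<close>

definition is_eigenvalue :: "real ^ 'n ^ 'n \<Rightarrow> complex \<Rightarrow> bool" where
  "is_eigenvalue M z \<longleftrightarrow> (\<exists>v. v \<noteq> 0 \<and> map_matrix of_real M *v v = z *s v)"

definition expanding :: "real ^ 'n ^ 'n \<Rightarrow> bool" where
  "expanding M \<longleftrightarrow> (\<forall>z. is_eigenvalue M z \<longrightarrow> cmod z > 1)"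

definition ifs_map :: "real ^ 2 ^ 2 \<Rightarrow> real ^ 2 \<Rightarrow> real ^ 2 \<Rightarrow> real ^ 2" where
  "ifs_map M d x = matrix_inv M *v (x + d)"

definition is_self_affine :: "real ^ 2 ^ 2 \<Rightarrow> (real ^ 2) set \<Rightarrow> (real ^ 2) measure \<Rightarrow> bool" where
  "is_self_affine M D \<mu> \<longleftrightarrow> prob_space \<mu> \<and> sets \<mu> = sets borel \<and>
     (\<forall>A \<in> sets borel. measure \<mu> A =
        1 / real (card D) * (\<Sum>d\<in>D. measure (distr \<mu> borel (ifs_map M d)) A))"

definition self_affine_measure :: "real ^ 2 ^ 2 \<Rightarrow> (real ^ 2) set \<Rightarrow> (real ^ 2) measure" where
  "self_affine_measure M D = (THE \<mu>. is_self_affine M D \<mu>)"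

definition E_grid :: "nat \<Rightarrow> (real ^ 2) set" where
  "E_grid p = {(1 / real p) *\<^sub>R of_int_vec l | l. \<forall>i. 0 \<le> l $ i \<and> l $ i \<le> int p - 1}"

definition E_grid0 :: "nat \<Rightarrow> (real ^ 2) set" where
  "E_grid0 p = E_grid p - {0}"

definition expo :: "real ^ 2 \<Rightarrow> real ^ 2 \<Rightarrow> complex" where
  "expo l x = exp (2 * of_real pi * \<i> * of_real (l \<bullet> x))"

definition mask :: "(int ^ 2) set \<Rightarrow> real ^ 2 \<Rightarrow> complex" where
  "mask D x = 1 / of_nat (card D) * (\<Sum>d\<in>D. expo (of_int_vec d) x)"

definition mask_zeros :: "(int ^ 2) set \<Rightarrow> (real ^ 2) set" where
  "mask_zeros D = {x. (\<forall>i. 0 \<le> x $ i \<and> x $ i < 1) \<and> mask D x = 0}"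

definition L2_inner :: "'a measure \<Rightarrow> ('a \<Rightarrow> complex) \<Rightarrow> ('a \<Rightarrow> complex) \<Rightarrow> complex" where
  "L2_inner \<mu> f g = (LINT x|\<mu>. f x * cnj (g x))"

definition orthogonal_exponentials :: "(real ^ 2) measure \<Rightarrow> (real ^ 2) set \<Rightarrow> bool" where
  "orthogonal_exponentials \<mu> \<Lambda> \<longleftrightarrow> countable \<Lambda> \<and>
     (\<forall>l\<in>\<Lambda>. \<forall>l'\<in>\<Lambda>. l \<noteq> l' \<longrightarrow> L2_inner \<mu> (expo l) (expo l') = 0)"

definition maximal_orthogonal_exponentials :: "(real ^ 2) measure \<Rightarrow> (real ^ 2) set \<Rightarrow> bool" where
  "maximal_orthogonal_exponentials \<mu> \<Lambda> \<longleftrightarrow> orthogonal_exponentials \<mu> \<Lambda> \<and>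
     (\<forall>\<Lambda>'. orthogonal_exponentials \<mu> \<Lambda>' \<and> \<Lambda> \<subseteq> \<Lambda>' \<longrightarrow> \<Lambda>' = \<Lambda>)"

text \<open>Needed because \<^const>\<open>card\<close> is \<open>0\<close> on infinite sets.\<close>

definition ecard :: "'a set \<Rightarrow> enat" where
  "ecard A = (if finite A then enat (card A) else \<infinity>)"

definition n_star :: "(real ^ 2) measure \<Rightarrow> enat" where
  "n_star \<mu> = Sup {ecard \<Lambda> | \<Lambda>. maximal_orthogonal_exponentials \<mu> \<Lambda>}"

text \<open>\<open>torus_proj x\<close> is the coset \<open>x + \<int>\<^sup>2\<close>, a point of \<open>\<real>\<^sup>2 / \<int>\<^sup>2\<close>.\<close>

definition torus_proj :: "real ^ 2 \<Rightarrow> (real ^ 2) set" where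
  "torus_proj x = range (\<lambda>k. x + of_int_vec k)"

definition zero_orbit :: "nat \<Rightarrow> (int ^ 2) set \<Rightarrow> int ^ 2 ^ 2 \<Rightarrow> (real ^ 2) set" where
  "zero_orbit p D M =
     (\<Union>j\<in>{1..p\<^sup>2 - 1}. ((\<lambda>x. transpose (of_int_mat M) *v x) ^^ j) ` mask_zeros D)"

definition matrix_class :: "nat \<Rightarrow> (int ^ 2 ^ 2) set" where
  "matrix_class p = {M. expanding (of_int_mat M) \<and> gcd (det M) (int p) = 1}"

definition matrix_class1 :: "nat \<Rightarrow> (int ^ 2) set \<Rightarrow> (int ^ 2 ^ 2) set" where
  "matrix_class1 p D =
     {M \<in> matrix_class p. torus_proj ` zero_orbit p D M \<subset> torus_proj ` E_grid0 p}"

definition matrix_class2 :: "nat \<Rightarrow> (int ^ 2) set \<Rightarrow> (int ^ 2 ^ 2) set" where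
  "matrix_class2 p D =
     {M \<in> matrix_class p. torus_proj ` zero_orbit p D M = torus_proj ` E_grid0 p}"

end

theory Submission
  imports Defs "HOL-Probability.Stream_Space"
begin

text \<open>
  Iterating the self-affinity relation and using that the inverse iterates of an expanding matrix
  tend to zero, the Fourier transform of \<open>\<mu>\<close> vanishes exactly on the union over \<open>j \<ge> 1\<close> of the images
  of the zero set of the mask under the \<open>j\<close>-th power of the transposed matrix. This set lies in
  \<open>(1/p) \<int>\<^sup>2\<close>, so after a translation an orthogonal set consists of grid points, pairwise incongruent
  modulo \<open>\<int>\<^sup>2\<close>, whence at most \<open>p\<^sup>2\<close> of them. For \<open>p \<in> {2, 3}\<close> the units modulo \<open>p\<close> are \<open>\<plusminus> 1\<close> and the
  zero set is symmetric; if it misses a class \<open>v\<close>, it therefore misses the line spanned by \<open>v\<close>, and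
  each of the \<open>p\<close> parallels of that line contains at most one point of an orthogonal set.
  Multiples of a single zero attain the bound \<open>p\<close>. If no class is missed, a high power of the
  transposed matrix maps representatives of all classes to an orthogonal set of \<open>p\<^sup>2\<close> points; the power
  is needed because an image of a full class under the transposed matrix is not a full class.
\<close>

section \<open>Inverse iterates of an expanding matrix\<close>

lemma matrix_inv_mult:
  fixes A :: "'a::field^'n^'n"
  assumes "det A \<noteq> 0"
  shows "A ** matrix_inv A = mat 1" "matrix_inv A ** A = mat 1"
proof -
  have "\<exists>B. A ** B = mat 1 \<and> B ** A = mat 1"
    using assms by (metis invertible_det_nz invertible_def)
  then have "A ** matrix_inv A = mat 1 \<and> matrix_inv A ** A = mat 1"
    unfolding matrix_inv_def by (rule someI_ex)
  then show "A ** matrix_inv A = mat 1" "matrix_inv A ** A = mat 1"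
    by simp_all
qed

text \<open>With \<open>v n = c (Suc n) - a * c n\<close> the recurrence factors: \<open>v\<close>
  is geometric with ratio \<open>b\<close>, and \<open>c\<close> satisfies a first-order recurrence
  with ratio \<open>a\<close> and summable forcing term \<open>v\<close>. This treats the double
  root \<open>a = b\<close> without a separate case.\<close>

lemma summable_norm_second_order_recurrence:
  fixes c :: "nat \<Rightarrow> complex"
  assumes a: "cmod a < 1" and b: "cmod b < 1"
    and rec: "\<And>n. c (Suc (Suc n)) = (a + b) * c (Suc n) - a * b * c n"
  shows "summable (\<lambda>n. cmod (c n))"
proof -
  define v where "v n = c (Suc n) - a * c n" for n
  have v: "v n = b ^ n * v 0" for n
  proof (induction n)
    case (Suc n)
    have "v (Suc n) = b * v n"
      by (simp add: v_def rec algebra_simps)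
    then show ?case
      by (simp add: Suc)
  qed simp
  define V where "V = (\<Sum>n. cmod (v n))"
  have sv: "summable (\<lambda>n. cmod (v n))"
  proof -
    have "(\<lambda>n. cmod (v n)) = (\<lambda>n. cmod b ^ n * cmod (v 0))"
      using v by (metis norm_mult norm_power)
    then show ?thesis
      using b by (simp add: summable_mult2 summable_geometric)
  qed
  have V: "(\<Sum>n<N. cmod (v n)) \<le> V" for N
    unfolding V_def using sv by (intro sum_le_suminf) auto
  \<comment> \<open>The partial sum is bounded by itself times \<open>cmod a\<close> plus a
    constant, and \<open>cmod a < 1\<close> lets it be absorbed on the left.\<close>
  have bound: "(\<Sum>n<N. cmod (c n)) \<le> (cmod (c 0) + V) / (1 - cmod a)" for N
  proof -
    have "(\<Sum>n<N. cmod (c n)) \<le> (\<Sum>n<Suc N. cmod (c n))"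
      by simp
    also have "\<dots> = cmod (c 0) + (\<Sum>n<N. cmod (c (Suc n)))"
      by (rule sum.lessThan_Suc_shift)
    also have "(\<Sum>n<N. cmod (c (Suc n))) \<le> (\<Sum>n<N. cmod a * cmod (c n) + cmod (v n))"
    proof (rule sum_mono)
      fix n
      have "c (Suc n) = a * c n + v n" by (simp add: v_def)
      then show "cmod (c (Suc n)) \<le> cmod a * cmod (c n) + cmod (v n)"
        by (metis norm_mult norm_triangle_ineq)
    qed
    also have "\<dots> = cmod a * (\<Sum>n<N. cmod (c n)) + (\<Sum>n<N. cmod (v n))"
      by (simp add: sum.distrib sum_distrib_left)
    finally have "(1 - cmod a) * (\<Sum>n<N. cmod (c n)) \<le> cmod (c 0) + V"
      using V[of N] by (simp add: algebra_simps)
    then show ?thesis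
      using a by (simp add: pos_le_divide_eq mult.commute)
  qed
  show ?thesis
    by (rule summableI_nonneg_bounded[OF _ bound]) simp
qed

text \<open>A root of the characteristic polynomial makes \<open>M - z\<close> singular, and a
  kernel vector is an eigenvector.\<close>

lemma is_eigenvalue_2I:
  fixes M :: "real^2^2"
  assumes "z\<^sup>2 - of_real (M$1$1 + M$2$2) * z + of_real (det M) = 0"
  shows "is_eigenvalue M z"
proof -
  let ?B = "map_matrix of_real M - mat z :: complex^2^2"
  have "det ?B = 0"
    using assms by (simp add: det_2 mat_def power2_eq_square algebra_simps)
  then have "\<not> invertible ?B"
    by (simp add: invertible_det_nz)
  then obtain v where v: "v \<noteq> 0" "?B *v v = 0"
    unfolding invertible_left_inverse matrix_left_invertible_ker by blast
  then have "map_matrix of_real M *v v = mat z *v v"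
    by (simp add: matrix_vector_mult_diff_rdistrib)
  also have "mat z *v v = z *s v"
    by (simp add: vec_eq_iff forall_2 matrix_vector_mult_def sum_2 mat_def)
  finally show ?thesis
    unfolding is_eigenvalue_def using v(1) by auto
qed

text \<open>By Cayley-Hamilton each coordinate of the inverse iterates obeys a second-order
  recurrence with characteristic roots \<open>1 / \<alpha>\<close> and \<open>1 / \<beta>\<close>,
  where \<open>\<alpha>\<close> and \<open>\<beta>\<close> are the eigenvalues of \<open>M\<close>.
  Expansion puts both roots inside the unit disc.\<close>

lemma expanding_summable_inverse_iterates:
  fixes M :: "real^2^2"
  assumes ex: "expanding M" and det: "det M \<noteq> 0"
  shows "summable (\<lambda>n. norm (((*v) (matrix_inv M) ^^ n) x))"
proof -
  define t where "t = M$1$1 + M$2$2"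
  \<comment> \<open>The complex root of the discriminant covers real and non-real eigenvalues at
    once.\<close>
  define s where "s = csqrt ((of_real t)\<^sup>2 - 4 * of_real (det M))"
  define \<alpha> where "\<alpha> = (of_real t + s) / 2"
  define \<beta> where "\<beta> = (of_real t - s) / 2"
  have s2: "s * s = (of_real t)\<^sup>2 - 4 * of_real (det M)"
    unfolding s_def by (metis power2_csqrt power2_eq_square)
  have sum: "\<alpha> + \<beta> = of_real t"
    by (simp add: \<alpha>_def \<beta>_def field_simps)
  have prod: "\<alpha> * \<beta> = of_real (det M)"
    using s2 by (simp add: \<alpha>_def \<beta>_def field_simps power2_eq_square)
  have root: "is_eigenvalue M z" if "z = \<alpha> \<or> z = \<beta>" for z
  proof (rule is_eigenvalue_2I)
    have "z\<^sup>2 - (\<alpha> + \<beta>) * z + \<alpha> * \<beta> = 0"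
      using that by (auto simp: power2_eq_square algebra_simps)
    then show "z\<^sup>2 - of_real (M$1$1 + M$2$2) * z + of_real (det M) = 0"
      by (simp add: sum prod t_def)
  qed
  have \<alpha>: "cmod \<alpha> > 1" and \<beta>: "cmod \<beta> > 1"
    using ex root unfolding expanding_def by auto
  then have nz: "\<alpha> \<noteq> 0" "\<beta> \<noteq> 0" by auto
  define u where "u n = ((*v) (matrix_inv M) ^^ n) x" for n
  have inv: "M *v u (Suc n) = u n" for n
    using det by (simp add: u_def matrix_vector_mul_assoc matrix_inv_mult)
  have CH: "M *v (M *v y) - t *\<^sub>R (M *v y) + det M *\<^sub>R y = 0" for y
    by (simp add: vec_eq_iff forall_2 matrix_vector_mult_def sum_2 det_2 t_def algebra_simps)
  have rec: "u n - t *\<^sub>R u (Suc n) + det M *\<^sub>R u (Suc (Suc n)) = 0" for n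
    using CH[of "u (Suc (Suc n))"] by (simp add: inv)
  have "summable (\<lambda>n. cmod (of_real (u n $ i)))" for i
  proof (rule summable_norm_second_order_recurrence)
    show "cmod (1 / \<alpha>) < 1" "cmod (1 / \<beta>) < 1"
      using \<alpha> \<beta> by (simp_all add: norm_divide divide_less_eq)
    fix n
    have "u n $ i - t * u (Suc n) $ i + det M * u (Suc (Suc n)) $ i = 0"
      using arg_cong[OF rec, of "\<lambda>v. v $ i" n] by simp
    then have "complex_of_real (u n $ i - t * u (Suc n) $ i + det M * u (Suc (Suc n)) $ i) = 0"
      by simp
    then have "complex_of_real (u n $ i) =
        (\<alpha> + \<beta>) * of_real (u (Suc n) $ i) - \<alpha> * \<beta> * of_real (u (Suc (Suc n)) $ i)"
      by (simp add: sum prod algebra_simps)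
    moreover have "w = (1 / \<alpha> + 1 / \<beta>) * v - 1 / \<alpha> * (1 / \<beta>) * ((\<alpha> + \<beta>) * v - \<alpha> * \<beta> * w)" for v w
      using nz by (simp add: field_simps)
    ultimately show "complex_of_real (u (Suc (Suc n)) $ i) =
        (1 / \<alpha> + 1 / \<beta>) * of_real (u (Suc n) $ i) - 1 / \<alpha> * (1 / \<beta>) * of_real (u n $ i)"
      by metis
  qed
  then have "summable (\<lambda>n. \<Sum>i\<in>UNIV. \<bar>u n $ i\<bar>)"
    by (intro summable_sum) simp
  then have "summable (\<lambda>n. norm (u n))"
    by (rule summable_comparison_test'[where N = 0]) (simp add: norm_le_l1_cart)
  then show ?thesis
    by (simp add: u_def)
qed

section \<open>Existence and uniqueness of the self-affine measure\<close>

text \<open>The indicator of a closed set is a pointwise limit of bounded Lipschitz functions, so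
  the integrals determine the measures of closed sets, hence of open sets, which generate the Borel
  sets.\<close>

lemma prob_measure_eqI_lipschitz:
  fixes \<mu> \<nu> :: "'a::metric_space measure"
  assumes "prob_space \<mu>" "prob_space \<nu>"
    and [measurable_cong]: "sets \<mu> = sets borel" "sets \<nu> = sets borel"
    and eq: "\<And>(f::'a \<Rightarrow> real) L. (\<And>x. \<bar>f x\<bar> \<le> 1) \<Longrightarrow> (\<And>x y. \<bar>f x - f y\<bar> \<le> L * dist x y) \<Longrightarrow>
      f \<in> borel_measurable borel \<Longrightarrow> integral\<^sup>L \<mu> f = integral\<^sup>L \<nu> f"
  shows "\<mu> = \<nu>"
proof -
  interpret \<mu>: prob_space \<mu> by fact
  interpret \<nu>: prob_space \<nu> by fact
  have sp: "space \<mu> = UNIV" "space \<nu> = UNIV"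
    using assms(3,4)[THEN sets_eq_imp_space_eq] by simp_all
  \<comment> \<open>The empty set is left out because \<open>infdist x {}\<close> is 0 by
    convention; accordingly \<open>UNIV\<close> is a separate case among the open sets
    below.\<close>
  have closed_eq: "measure \<mu> C = measure \<nu> C" if "closed C" "C \<noteq> {}" for C
  proof -
    define f where "f k x = max 0 (1 - real k * infdist x C)" for k x
    have f_bd: "\<bar>f k x\<bar> \<le> 1" for k x
      by (auto simp: f_def infdist_nonneg)
    have f_lip: "\<bar>f k x - f k y\<bar> \<le> real k * dist x y" for k x y
    proof -
      have "\<bar>f k x - f k y\<bar> \<le> \<bar>real k * infdist x C - real k * infdist y C\<bar>"
        by (auto simp: f_def max_def)
      also have "\<dots> = real k * \<bar>infdist x C - infdist y C\<bar>"
        by (simp add: abs_mult flip: right_diff_distrib)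
      also have "\<dots> \<le> real k * dist x y"
        by (intro mult_left_mono infdist_triangle_abs) simp
      finally show ?thesis .
    qed
    have f_meas [measurable]: "f k \<in> borel_measurable borel" for k
      unfolding f_def by (intro borel_measurable_continuous_onI continuous_intros)
    have f_lim: "(\<lambda>k. f k x) \<longlonglongrightarrow> indicator C x" for x
    proof (cases "x \<in> C")
      case True
      then show ?thesis by (simp add: f_def)
    next
      case False
      then have pos: "infdist x C > 0"
        using that by (simp add: infdist_pos_not_in_closed)
      obtain N where N: "1 < real N * infdist x C"
        using reals_Archimedean3[OF pos] by blast
      have "f k x = 0" if "k \<ge> N" for k
      proof -
        have "real N * infdist x C \<le> real k * infdist x C"
          using that pos by (intro mult_right_mono) auto
        then show ?thesis
          using N by (simp add: f_def)
      qed
      then have "eventually (\<lambda>k. f k x = 0) sequentially"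
        by (auto simp: eventually_sequentially)
      then show ?thesis
        using False by (simp add: tendsto_eventually)
    qed
    have [measurable]: "C \<in> sets borel"
      using that by simp
    have "(\<lambda>k. integral\<^sup>L \<mu> (f k)) \<longlonglongrightarrow> integral\<^sup>L \<mu> (indicator C)"
      by (rule integral_dominated_convergence[where w = "\<lambda>_. 1"]) (use f_lim f_bd in auto)
    moreover have "(\<lambda>k. integral\<^sup>L \<nu> (f k)) \<longlonglongrightarrow> integral\<^sup>L \<nu> (indicator C)"
      by (rule integral_dominated_convergence[where w = "\<lambda>_. 1"]) (use f_lim f_bd in auto)
    moreover have "integral\<^sup>L \<mu> (f k) = integral\<^sup>L \<nu> (f k)" for k
      by (rule eq[OF f_bd f_lip f_meas])
    ultimately have "integral\<^sup>L \<mu> (indicator C :: _ \<Rightarrow> real) = integral\<^sup>L \<nu> (indicator C)"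
      using LIMSEQ_unique by auto
    then show ?thesis
      by (simp add: sp)
  qed
  show ?thesis
  proof (rule measure_eqI_generator_eq[where E = "{S. open S}" and \<Omega> = UNIV and A = "\<lambda>_. UNIV"])
    show "Int_stable {S::'a set. open S}"
      by (auto simp: Int_stable_def)
    show "emeasure \<mu> X = emeasure \<nu> X" if "X \<in> {S. open S}" for X
    proof (cases "X = UNIV")
      case True
      then show ?thesis
        using \<mu>.emeasure_space_1 \<nu>.emeasure_space_1 by (simp add: sp)
    next
      case False
      have [simp]: "X \<in> sets borel"
        using that by simp
      have "measure \<mu> (- X) = measure \<nu> (- X)"
        using that False by (intro closed_eq) (auto simp: closed_def)
      moreover have "measure \<mu> (- X) = 1 - measure \<mu> X"
        using \<mu>.prob_compl[of X] by (simp add: sp assms Compl_eq_Diff_UNIV)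
      moreover have "measure \<nu> (- X) = 1 - measure \<nu> X"
        using \<nu>.prob_compl[of X] by (simp add: sp assms Compl_eq_Diff_UNIV)
      ultimately show ?thesis
        by (simp add: \<mu>.emeasure_eq_measure \<nu>.emeasure_eq_measure)
    qed
  qed (auto simp: assms sets_borel)
qed

section \<open>Coding by digit streams and existence\<close>

text \<open>Expansion is recorded here as summability of the inverse iterates, the form in which the
  address series and the limits below use it.\<close>

locale contracting_ifs =
  fixes M :: "real^2^2" and D :: "(real^2) set"
  assumes det_nz: "det M \<noteq> 0"
    and finite_D: "finite D" and D_ne: "D \<noteq> {}"
    and summable_iterates: "summable (\<lambda>n. norm (((*v) (matrix_inv M) ^^ n) x))"
begin

abbreviation "S \<equiv> (*v) (matrix_inv M)"

lemma iterates_tendsto_0: "(\<lambda>n. (S ^^ n) x) \<longlonglongrightarrow> 0"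
  using summable_LIMSEQ_zero[OF summable_iterates] by (rule tendsto_norm_zero_cancel)

lemma ifs_map_diff: "ifs_map M d x - ifs_map M d y = S (x - y)"
  by (simp add: ifs_map_def matrix_vector_mult_diff_distrib matrix_vector_right_distrib)

lemma continuous_ifs_map: "continuous_on UNIV (ifs_map M d)"
  unfolding ifs_map_def
  by (intro continuous_intros matrix_vector_mult_linear_continuous_on[THEN continuous_on_compose2]) auto

lemma borel_measurable_ifs_map [measurable]: "ifs_map M d \<in> borel_measurable borel"
  by (intro borel_measurable_continuous_onI continuous_ifs_map)

text \<open>Truncating the digits outside \<open>D\<close> makes the address series converge for every stream.\<close>

definition digit :: "real^2 \<Rightarrow> real^2" where
  "digit d = (if d \<in> D then d else 0)"

definition address :: "(real^2) stream \<Rightarrow> real^2" where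
  "address \<omega> = (\<Sum>n. (S ^^ Suc n) (digit (\<omega> !! n)))"

lemma summable_address: "summable (\<lambda>n. (S ^^ n) (digit (\<omega> n)))"
proof (rule summable_comparison_test'[where N = 0])
  show "summable (\<lambda>n. \<Sum>d\<in>insert 0 D. norm ((S ^^ n) d))"
    by (intro summable_sum summable_iterates)
  show "norm ((S ^^ n) (digit (\<omega> n))) \<le> (\<Sum>d\<in>insert 0 D. norm ((S ^^ n) d))" for n
    using finite_D
    by (intro member_le_sum[of "digit (\<omega> n)" _ "\<lambda>d. norm ((S ^^ n) d)"]) (auto simp: digit_def)
qed

text \<open>Prefixing a digit shifts the address series by one power of \<open>S\<close> and adds
  \<open>S d\<close>, which is exactly one step of the iterated function system. The exponent
  \<open>Suc n\<close> in \<open>address\<close> is chosen for this.\<close>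

lemma address_Stream:
  assumes "d \<in> D"
  shows "address (d ## \<omega>) = ifs_map M d (address \<omega>)"
proof -
  have "summable (\<lambda>n. (S ^^ Suc n) (digit ((d ## \<omega>) !! n)))" (is "summable ?f")
    \<comment> \<open>The index \<open>n - 1\<close> lines the digits up with the powers
      \<open>Suc n\<close> once the term at 0 is dropped.\<close>
    using summable_address[of "\<lambda>n. (d ## \<omega>) !! (n - 1)"] by (subst (asm) summable_Suc_iff[symmetric]) simp
  then have "address (d ## \<omega>) = S (digit d) + (\<Sum>n. (S ^^ Suc (Suc n)) (digit (\<omega> !! n)))"
    unfolding address_def using suminf_split_head[of ?f] by simp
  also have "(\<Sum>n. (S ^^ Suc (Suc n)) (digit (\<omega> !! n))) = (\<Sum>n. S ((S ^^ Suc n) (digit (\<omega> !! n))))"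
    by simp
  also have "\<dots> = S (address \<omega>)"
    unfolding address_def
  proof (rule bounded_linear.suminf[OF matrix_vector_mul_bounded_linear, symmetric])
    show "summable (\<lambda>n. (S ^^ Suc n) (digit (\<omega> !! n)))"
      using summable_address[of "\<lambda>n. \<omega> !! (n - 1)"] by (subst (asm) summable_Suc_iff[symmetric]) simp
  qed
  finally show ?thesis
    using assms by (simp add: ifs_map_def digit_def matrix_vector_right_distrib add.commute)
qed

abbreviation "Q \<equiv> measure_pmf (pmf_of_set D)"

lemma measurable_address [measurable]: "address \<in> stream_space Q \<rightarrow>\<^sub>M borel"
  unfolding address_def
proof (rule borel_measurable_suminf)
  show "(\<lambda>\<omega>. (S ^^ Suc n) (digit (\<omega> !! n))) \<in> borel_measurable (stream_space Q)" for n
    by (rule measurable_compose[OF measurable_snth]) simp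
qed

text \<open>The witness is the law of the address of a stream of independent uniform digits.
  Splitting off the first digit leaves a stream with the same law, and \<open>address_Stream\<close>
  turns this into the self-affinity relation.\<close>

lemma ex_is_self_affine: "\<exists>\<mu>. is_self_affine M D \<mu>"
proof
  let ?\<mu> = "distr (stream_space Q) borel address"
  interpret st: prob_space "stream_space Q" by (rule prob_space.prob_space_stream_space[OF prob_space_measure_pmf])
  interpret \<mu>: prob_space ?\<mu> by (rule st.prob_space_distr) simp
  have sp: "space (stream_space Q) = UNIV"
    by (simp add: space_stream_space)
  have "measure ?\<mu> B = 1 / real (card D) * (\<Sum>d\<in>D. measure (distr ?\<mu> borel (ifs_map M d)) B)"
    if [measurable]: "B \<in> sets borel" for B
  proof -
    have "emeasure ?\<mu> B = emeasure (stream_space Q) (address -` B)"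
      by (simp add: emeasure_distr sp)
    also have "\<dots> = (\<integral>\<^sup>+ t. emeasure (stream_space Q) {x \<in> space (stream_space Q). t ## x \<in> address -` B} \<partial>Q)"
      using measurable_sets[OF measurable_address that] by (intro prob_space.emeasure_stream_space[OF prob_space_measure_pmf]) (simp add: sp)
    also have "\<dots> = (\<integral>\<^sup>+ t. emeasure (distr ?\<mu> borel (ifs_map M t)) B \<partial>Q)"
    proof (rule nn_integral_cong_AE, rule AE_pmfI)
      fix t assume "t \<in> set_pmf (pmf_of_set D)"
      then have t: "t \<in> D"
        using finite_D D_ne by simp
      have "emeasure (distr ?\<mu> borel (ifs_map M t)) B = emeasure (stream_space Q) (address -` ifs_map M t -` B)"
        by (simp add: emeasure_distr sp measurable_sets_borel[OF borel_measurable_ifs_map])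
      then show "emeasure (stream_space Q) {x \<in> space (stream_space Q). t ## x \<in> address -` B}
          = emeasure (distr ?\<mu> borel (ifs_map M t)) B"
        by (simp add: sp address_Stream[OF t] vimage_def)
    qed
    also have "\<dots> = (\<Sum>d\<in>D. emeasure (distr ?\<mu> borel (ifs_map M d)) B) / card D"
      using finite_D D_ne by (simp add: nn_integral_pmf_of_set)
    also have "\<dots> = (\<Sum>d\<in>D. ennreal (measure (distr ?\<mu> borel (ifs_map M d)) B)) / card D"
    proof -
      have "prob_space (distr ?\<mu> borel (ifs_map M d))" for d
        by (rule \<mu>.prob_space_distr) simp
      then interpret prob_space "distr ?\<mu> borel (ifs_map M d)" for d .
      show ?thesis by (simp add: emeasure_eq_measure)
    qed
    also have "\<dots> = ennreal (1 / real (card D) * (\<Sum>d\<in>D. measure (distr ?\<mu> borel (ifs_map M d)) B))"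
      using finite_D D_ne
      by (simp add: sum_ennreal divide_ennreal sum_nonneg card_gt_0_iff ennreal_of_nat_eq_real_of_nat)
    finally show ?thesis
      unfolding \<mu>.emeasure_eq_measure by (subst (asm) ennreal_inj) (auto intro!: sum_nonneg divide_nonneg_nonneg)
  qed
  then show "is_self_affine M D ?\<mu>"
    unfolding is_self_affine_def using \<mu>.prob_space_axioms by simp
qed

text \<open>Self-affinity says that \<open>\<mu>\<close> is the law of \<open>ifs_map M d x\<close>
  for independent uniform \<open>d\<close> and \<open>\<mu>\<close>-distributed \<open>x\<close>.
  Change of variables and Fubini carry this from sets to bounded functions.\<close>

lemma is_self_affine_integral:
  fixes f :: "real^2 \<Rightarrow> 'b::{banach, second_countable_topology}"
  assumes sa: "is_self_affine M D \<mu>"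
    and [measurable]: "f \<in> borel_measurable borel" and bd: "\<And>x. norm (f x) \<le> B"
  shows "integral\<^sup>L \<mu> f = (1 / real (card D)) *\<^sub>R (\<Sum>d\<in>D. \<integral>x. f (ifs_map M d x) \<partial>\<mu>)"
proof -
  interpret \<mu>: prob_space \<mu> using sa by (simp add: is_self_affine_def)
  interpret Q\<mu>: pair_prob_space Q \<mu> ..
  have sets [measurable_cong]: "sets \<mu> = sets borel" using sa by (simp add: is_self_affine_def)
  then have sp: "space \<mu> = UNIV" by (auto dest: sets_eq_imp_space_eq)
  have [measurable]: "(\<lambda>p. fst p) \<in> Q \<Otimes>\<^sub>M \<mu> \<rightarrow>\<^sub>M (borel :: (real^2) measure)"
    by (rule measurable_compose[OF measurable_fst]) simp
  have meas [measurable]: "(\<lambda>(d, x). ifs_map M d x) \<in> Q \<Otimes>\<^sub>M \<mu> \<rightarrow>\<^sub>M borel"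
  proof -
    have "(\<lambda>p. snd p + fst p) \<in> Q \<Otimes>\<^sub>M \<mu> \<rightarrow>\<^sub>M borel"
      by measurable
    moreover have "S \<in> borel_measurable borel"
      by (intro borel_measurable_continuous_onI matrix_vector_mult_linear_continuous_on)
    ultimately have "(\<lambda>p. S (snd p + fst p)) \<in> Q \<Otimes>\<^sub>M \<mu> \<rightarrow>\<^sub>M borel"
      by (rule measurable_compose)
    then show ?thesis
      by (simp add: ifs_map_def case_prod_beta')
  qed
  have "\<mu> = distr (Q \<Otimes>\<^sub>M \<mu>) borel (\<lambda>(d, x). ifs_map M d x)" (is "_ = ?\<nu>")
  proof (rule measure_eqI)
    fix X assume "X \<in> sets \<mu>"
    then have [measurable]: "X \<in> sets borel" by (simp add: sets)
    have m: "measure (distr \<mu> borel (ifs_map M d)) X = measure \<mu> (ifs_map M d -` X)" for d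
      by (simp add: measure_distr sp)
    have "emeasure ?\<nu> X = emeasure (Q \<Otimes>\<^sub>M \<mu>) ((\<lambda>(d, x). ifs_map M d x) -` X \<inter> space (Q \<Otimes>\<^sub>M \<mu>))"
      by (rule emeasure_distr) simp_all
    also have "\<dots> = (\<integral>\<^sup>+ d. emeasure \<mu> (ifs_map M d -` X) \<partial>Q)"
    proof -
      have "(\<lambda>(d, x). ifs_map M d x) -` X \<inter> space (Q \<Otimes>\<^sub>M \<mu>) \<in> sets (Q \<Otimes>\<^sub>M \<mu>)"
        by (rule measurable_sets[OF meas]) simp
      then show ?thesis
        by (simp add: \<mu>.emeasure_pair_measure_alt vimage_def space_pair_measure sp)
    qed
    also have "\<dots> = (\<Sum>d\<in>D. emeasure \<mu> (ifs_map M d -` X)) / card D"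
      using finite_D D_ne by (simp add: nn_integral_pmf_of_set)
    also have "\<dots> = ennreal (1 / real (card D) * (\<Sum>d\<in>D. measure \<mu> (ifs_map M d -` X)))"
      unfolding \<mu>.emeasure_eq_measure using finite_D D_ne
      by (simp add: sum_ennreal divide_ennreal sum_nonneg card_gt_0_iff ennreal_of_nat_eq_real_of_nat)
    also have "\<dots> = emeasure \<mu> X"
      using sa by (simp add: is_self_affine_def \<mu>.emeasure_eq_measure m)
    finally show "emeasure \<mu> X = emeasure ?\<nu> X" ..
  qed (simp add: sets)
  then have "integral\<^sup>L \<mu> f = integral\<^sup>L ?\<nu> f"
    by simp
  also have "\<dots> = (\<integral>p. f (case p of (d, x) \<Rightarrow> ifs_map M d x) \<partial>(Q \<Otimes>\<^sub>M \<mu>))"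
    by (rule integral_distr) simp_all
  also have "\<dots> = (\<integral>d. \<integral>x. f (ifs_map M d x) \<partial>\<mu> \<partial>Q)"
  proof -
    have "integrable (Q \<Otimes>\<^sub>M \<mu>) (\<lambda>p. f (case p of (d, x) \<Rightarrow> ifs_map M d x))"
      by (rule Q\<mu>.integrable_const_bound[of _ B]) (use bd in simp_all)
    from Q\<mu>.integral_fst'[OF this] show ?thesis by simp
  qed
  also have "\<dots> = (1 / real (card D)) *\<^sub>R (\<Sum>d\<in>D. \<integral>x. f (ifs_map M d x) \<partial>\<mu>)"
    using finite_D D_ne
    by (subst integral_measure_pmf[of D]) (simp_all add: scaleR_sum_right)
  finally show ?thesis .
qed

section \<open>Transfer operator and uniqueness\<close>

definition transfer_op :: "(real^2 \<Rightarrow> real) \<Rightarrow> real^2 \<Rightarrow> real" where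
  "transfer_op f x = (1 / real (card D)) * (\<Sum>d\<in>D. f (ifs_map M d x))"

text \<open>Two functions and two points are allowed so that one estimate gives both the sup bound
  (\<open>g = 0\<close>) and the contraction of Lipschitz bounds (\<open>f = g\<close>).\<close>

lemma transfer_op_bound:
  assumes "\<And>d. d \<in> D \<Longrightarrow> \<bar>f (ifs_map M d x) - g (ifs_map M d y)\<bar> \<le> B"
  shows "\<bar>transfer_op f x - transfer_op g y\<bar> \<le> B"
proof -
  have "\<bar>\<Sum>d\<in>D. f (ifs_map M d x) - g (ifs_map M d y)\<bar> \<le> (\<Sum>d\<in>D. B)"
    using assms by (intro order_trans[OF sum_abs] sum_mono) auto
  then have "\<bar>\<Sum>d\<in>D. f (ifs_map M d x) - g (ifs_map M d y)\<bar> / real (card D) \<le> B"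
    using finite_D D_ne by (simp add: card_gt_0_iff pos_divide_le_eq mult.commute)
  then show ?thesis
    by (simp add: transfer_op_def sum_subtractf abs_divide flip: diff_divide_distrib)
qed

lemma integral_transfer_op:
  assumes sa: "is_self_affine M D \<mu>" and [measurable]: "f \<in> borel_measurable borel"
    and bd: "\<And>x. \<bar>f x\<bar> \<le> B"
  shows "integral\<^sup>L \<mu> (transfer_op f) = integral\<^sup>L \<mu> f"
proof -
  interpret \<mu>: prob_space \<mu> using sa by (simp add: is_self_affine_def)
  have [measurable_cong]: "sets \<mu> = sets borel" using sa by (simp add: is_self_affine_def)
  have int: "integrable \<mu> (\<lambda>x. f (ifs_map M d x))" for d
    by (rule \<mu>.integrable_const_bound[of _ B]) (use bd in simp_all)
  have "integral\<^sup>L \<mu> f = (1 / real (card D)) *\<^sub>R (\<Sum>d\<in>D. \<integral>x. f (ifs_map M d x) \<partial>\<mu>)"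
    by (rule is_self_affine_integral[OF sa _, of _ B]) (use bd in simp_all)
  also have "\<dots> = integral\<^sup>L \<mu> (transfer_op f)"
    using int by (simp add: transfer_op_def[abs_def])
  finally show ?thesis ..
qed

text \<open>Iterating the operator keeps the integral but flattens \<open>f\<close>, since the
  oscillation between \<open>x\<close> and \<open>y\<close> is at most
  \<open>L * norm ((S ^^ n) (x - y))\<close>. The limiting sequence does not mention
  \<open>\<mu>\<close>, which gives uniqueness.\<close>

lemma self_affine_integral_tendsto:
  assumes sa: "is_self_affine M D \<mu>" and [measurable]: "f \<in> borel_measurable borel"
    and bd: "\<And>x. \<bar>f x\<bar> \<le> 1" and lip: "\<And>x y. \<bar>f x - f y\<bar> \<le> L * dist x y"
  shows "(\<lambda>n. (transfer_op ^^ n) f 0) \<longlonglongrightarrow> integral\<^sup>L \<mu> f"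
proof -
  interpret \<mu>: prob_space \<mu> using sa by (simp add: is_self_affine_def)
  have sets [measurable_cong]: "sets \<mu> = sets borel" using sa by (simp add: is_self_affine_def)
  have meas [measurable]: "(transfer_op ^^ n) f \<in> borel_measurable borel" for n
    by (induction n) (simp_all add: transfer_op_def[abs_def])
  have bdn: "\<bar>(transfer_op ^^ n) f x\<bar> \<le> 1" for n x
  proof (induction n arbitrary: x)
    case (Suc n)
    have "\<bar>transfer_op ((transfer_op ^^ n) f) x - transfer_op (\<lambda>_. 0) x\<bar> \<le> 1"
      by (rule transfer_op_bound) (use Suc in simp)
    moreover have "transfer_op (\<lambda>_. 0) x = 0"
      by (simp add: transfer_op_def)
    ultimately show ?case
      by simp
  qed (simp add: bd)
  have lipn: "\<bar>(transfer_op ^^ n) f x - (transfer_op ^^ n) f y\<bar> \<le> L * norm ((S ^^ n) (x - y))" for n x y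
  proof (induction n arbitrary: x y)
    case (Suc n)
    have "\<bar>transfer_op ((transfer_op ^^ n) f) x - transfer_op ((transfer_op ^^ n) f) y\<bar>
        \<le> L * norm ((S ^^ n) (S (x - y)))"
      by (rule transfer_op_bound) (metis Suc ifs_map_diff)
    then show ?case
      by (simp add: funpow_swap1)
  qed (use lip in \<open>simp add: dist_norm\<close>)
  have int_eq: "integral\<^sup>L \<mu> ((transfer_op ^^ n) f) = integral\<^sup>L \<mu> f" for n
    by (induction n) (simp_all add: integral_transfer_op[OF sa meas bdn])
  have "(\<lambda>n. \<integral>x. ((transfer_op ^^ n) f x - (transfer_op ^^ n) f 0) \<partial>\<mu>) \<longlonglongrightarrow> (\<integral>x. 0 \<partial>\<mu>)"
  proof (rule integral_dominated_convergence[where w = "\<lambda>_. 2"])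
    show "AE x in \<mu>. (\<lambda>n. (transfer_op ^^ n) f x - (transfer_op ^^ n) f 0) \<longlonglongrightarrow> 0"
    proof (rule AE_I2, rule Lim_null_comparison)
      fix x
      show "\<forall>\<^sub>F n in sequentially. norm ((transfer_op ^^ n) f x - (transfer_op ^^ n) f 0)
          \<le> L * norm ((S ^^ n) x)"
        using lipn[of _ x 0] by simp
      show "(\<lambda>n. L * norm ((S ^^ n) x)) \<longlonglongrightarrow> 0"
        using summable_LIMSEQ_zero[OF summable_iterates] by (rule tendsto_mult_right_zero)
    qed
    show "AE x in \<mu>. norm ((transfer_op ^^ n) f x - (transfer_op ^^ n) f 0) \<le> 2" for n
    proof (rule AE_I2)
      fix x
      show "norm ((transfer_op ^^ n) f x - (transfer_op ^^ n) f 0) \<le> 2"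
        using bdn[of n x] bdn[of n 0] by simp
    qed
  qed simp_all
  moreover have "(\<integral>x. ((transfer_op ^^ n) f x - (transfer_op ^^ n) f 0) \<partial>\<mu>)
      = integral\<^sup>L \<mu> f - (transfer_op ^^ n) f 0" for n
  proof -
    have "integrable \<mu> ((transfer_op ^^ n) f)"
      by (rule \<mu>.integrable_const_bound[of _ 1]) (use bdn in simp_all)
    then show ?thesis
      by (simp add: int_eq \<mu>.prob_space)
  qed
  ultimately have "(\<lambda>n. integral\<^sup>L \<mu> f - (transfer_op ^^ n) f 0) \<longlonglongrightarrow> 0"
    by simp
  from tendsto_diff[OF tendsto_const[of "integral\<^sup>L \<mu> f"] this] show ?thesis
    by simp
qed

lemma is_self_affine_unique:
  assumes "is_self_affine M D \<mu>" "is_self_affine M D \<nu>"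
  shows "\<mu> = \<nu>"
proof (rule prob_measure_eqI_lipschitz)
  show "integral\<^sup>L \<mu> f = integral\<^sup>L \<nu> f" if "\<And>x. \<bar>f x\<bar> \<le> 1" "\<And>x y. \<bar>f x - f y\<bar> \<le> L * dist x y"
    "f \<in> borel_measurable borel" for f L
    using self_affine_integral_tendsto[OF assms(1) that(3,1,2)]
      self_affine_integral_tendsto[OF assms(2) that(3,1,2)] by (rule LIMSEQ_unique)
qed (use assms in \<open>simp_all add: is_self_affine_def\<close>)

lemma is_self_affine_self_affine_measure: "is_self_affine M D (self_affine_measure M D)"
  unfolding self_affine_measure_def
  using ex_is_self_affine is_self_affine_unique by (metis theI)

end

section \<open>Zeros of the Fourier transform\<close>

lemma expo_add_right: "expo l (x + y) = expo l x * expo l y"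
  by (simp add: expo_def inner_add_right algebra_simps exp_add)

lemma expo_mult_cnj: "expo l x * cnj (expo l' x) = expo (l - l') x"
  by (simp add: expo_def exp_cnj inner_diff_left algebra_simps flip: exp_add)

lemma expo_commute: "expo l x = expo x l"
  by (simp add: expo_def inner_commute)

lemma norm_expo [simp]: "norm (expo l x) = 1"
  by (simp add: expo_def)

lemma expo_vector_matrix_mult: "expo (l v* N) x = expo l (N *v x)"
  by (simp add: expo_def dot_lmul_matrix)

lemma borel_measurable_expo [measurable]: "expo l \<in> borel_measurable borel"
  unfolding expo_def by (intro borel_measurable_continuous_onI continuous_intros)

context contracting_ifs
begin

abbreviation "\<mu> \<equiv> self_affine_measure M D"

sublocale \<mu>: prob_space \<mu>
  using is_self_affine_self_affine_measure by (simp add: is_self_affine_def)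

lemma sets_\<mu> [measurable_cong, simp]: "sets \<mu> = sets borel"
  using is_self_affine_self_affine_measure by (simp add: is_self_affine_def)

definition char_fun :: "real^2 \<Rightarrow> complex" where
  "char_fun l = integral\<^sup>L \<mu> (expo l)"

definition digit_sum :: "real^2 \<Rightarrow> complex" where
  "digit_sum l = (\<Sum>d\<in>D. expo d l)"

lemma L2_inner_expo: "L2_inner \<mu> (expo l) (expo l') = char_fun (l - l')"
  unfolding L2_inner_def char_fun_def expo_mult_cnj ..

text \<open>Moving \<open>M\<close> across the inner product cancels the inverse in
  \<open>ifs_map\<close>, and the character of \<open>x + d\<close> splits. The product
  \<open>l v* M\<close> is the transpose of \<open>M\<close> applied to \<open>l\<close>.\<close>

lemma char_fun_refinement: "char_fun (l v* M) = of_real (1 / real (card D)) * digit_sum l * char_fun l"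
proof -
  have "expo (l v* M) (ifs_map M d x) = expo d l * expo l x" for d x
  proof -
    have "expo (l v* M) (ifs_map M d x) = expo l (x + d)"
      unfolding expo_vector_matrix_mult ifs_map_def
      by (simp add: matrix_vector_mul_assoc matrix_inv_mult det_nz)
    then show ?thesis
      by (simp add: expo_add_right expo_commute[of d])
  qed
  moreover have "char_fun (l v* M) =
      (1 / real (card D)) *\<^sub>R (\<Sum>d\<in>D. \<integral>x. expo (l v* M) (ifs_map M d x) \<partial>\<mu>)"
    unfolding char_fun_def
    by (rule is_self_affine_integral[OF is_self_affine_self_affine_measure, of _ 1]) simp_all
  ultimately show ?thesis
    by (simp add: char_fun_def digit_sum_def sum_distrib_right scaleR_conv_of_real)
qed

text \<open>The iterates pass to the argument \<open>x\<close>, where they tend to 0, and dominated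
  convergence applies.\<close>

lemma char_fun_iterates_tendsto: "(\<lambda>n. char_fun (((\<lambda>l. l v* matrix_inv M) ^^ n) l)) \<longlonglongrightarrow> 1"
proof -
  have expo_iter: "expo (((\<lambda>l. l v* matrix_inv M) ^^ n) l) x = expo l ((S ^^ n) x)" for n x
    by (induction n arbitrary: x) (simp_all add: expo_vector_matrix_mult funpow_swap1)
  have "(\<lambda>n. \<integral>x. expo (((\<lambda>l. l v* matrix_inv M) ^^ n) l) x \<partial>\<mu>) \<longlonglongrightarrow> (\<integral>x. 1 \<partial>\<mu>)"
  proof (rule integral_dominated_convergence[where w = "\<lambda>_. 1"])
    show "AE x in \<mu>. (\<lambda>n. expo (((\<lambda>l. l v* matrix_inv M) ^^ n) l) x) \<longlonglongrightarrow> 1"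
    proof (rule AE_I2)
      fix x
      have "(\<lambda>n. expo l ((S ^^ n) x)) \<longlonglongrightarrow> expo l 0"
        unfolding expo_def by (intro tendsto_intros iterates_tendsto_0)
      then show "(\<lambda>n. expo (((\<lambda>l. l v* matrix_inv M) ^^ n) l) x) \<longlonglongrightarrow> 1"
        unfolding expo_iter by (simp add: expo_def)
    qed
  qed simp_all
  then show ?thesis
    by (simp add: char_fun_def \<mu>.prob_space)
qed

text \<open>This replaces the infinite product formula: if no digit sum vanished along the inverse
  orbit of \<open>l\<close>, a zero at \<open>l\<close> would propagate along that orbit and
  contradict the limit 1.\<close>

theorem char_fun_eq_0_iff:
  "char_fun l = 0 \<longleftrightarrow> (\<exists>j\<ge>1. \<exists>l'. l = ((\<lambda>l. l v* M) ^^ j) l' \<and> digit_sum l' = 0)"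
proof
  assume "\<exists>j\<ge>1. \<exists>l'. l = ((\<lambda>l. l v* M) ^^ j) l' \<and> digit_sum l' = 0"
  then obtain j l' where j: "j \<ge> 1" and l: "l = ((\<lambda>l. l v* M) ^^ j) l'" and zero: "digit_sum l' = 0"
    by blast
  have "char_fun (((\<lambda>l. l v* M) ^^ j) l') = 0"
    using j by (induction j rule: dec_induct) (simp_all add: char_fun_refinement zero)
  then show "char_fun l = 0"
    by (simp add: l)
next
  assume zero: "char_fun l = 0"
  show "\<exists>j\<ge>1. \<exists>l'. l = ((\<lambda>l. l v* M) ^^ j) l' \<and> digit_sum l' = 0"
  proof (rule ccontr)
    assume contra: "\<not> (\<exists>j\<ge>1. \<exists>l'. l = ((\<lambda>l. l v* M) ^^ j) l' \<and> digit_sum l' = 0)"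
    define u where "u n = ((\<lambda>l. l v* matrix_inv M) ^^ n) l" for n
    have step: "u (Suc n) v* M = u n" for n
    proof -
      have "u (Suc n) v* M = transpose M *v (transpose (matrix_inv M) *v u n)"
        by (simp add: u_def)
      also have "\<dots> = transpose (matrix_inv M ** M) *v u n"
        by (simp only: matrix_transpose_mul matrix_vector_mul_assoc)
      finally show ?thesis
        by (simp add: matrix_inv_mult det_nz transpose_mat)
    qed
    have iter_u: "((\<lambda>l. l v* M) ^^ n) (u n) = l" for n
      by (induction n) (simp_all add: u_def[of 0] funpow_Suc_right step del: funpow.simps(2))
    have "char_fun (u n) = 0" for n
    proof (induction n)
      case 0
      then show ?case by (simp add: u_def zero)
    next
      case (Suc n)
      have "digit_sum (u (Suc n)) \<noteq> 0"
        using contra iter_u[of "Suc n"] by (metis le_add1 plus_1_eq_Suc)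
      then show ?case
        using char_fun_refinement[of "u (Suc n)"] Suc finite_D D_ne by (simp add: step)
    qed
    then have "(\<lambda>n. 0) \<longlonglongrightarrow> (1::complex)"
      using char_fun_iterates_tendsto[of l] by (simp add: u_def)
    then show False
      by (simp add: LIMSEQ_const_iff)
  qed
qed

end

section \<open>Orbits modulo p\<close>

text \<open>Integer vectors serve as numerators of points of (1/p)Z^2, so this congruence encodes
  equality in the torus.\<close>

definition vcong :: "nat \<Rightarrow> int^'n \<Rightarrow> int^'n \<Rightarrow> bool" where
  "vcong p u v \<longleftrightarrow> (\<forall>i. int p dvd u $ i - v $ i)"

lemma vcong_refl [simp]: "vcong p v v"
  by (simp add: vcong_def)

lemma vcong_sym: "vcong p u v \<Longrightarrow> vcong p v u"
  by (metis dvd_minus_iff minus_diff_eq vcong_def)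

lemma vcong_trans: "vcong p u v \<Longrightarrow> vcong p v w \<Longrightarrow> vcong p u w"
  unfolding vcong_def by (metis diff_add_cancel add_diff_eq dvd_add)

lemma vcong_minus: "vcong p u v \<Longrightarrow> vcong p (- u) (- v)"
  unfolding vcong_def by (metis dvd_minus_iff minus_diff_minus vector_uminus_component)

lemma vcong_vector_matrix_mult:
  fixes M :: "int^2^2"
  assumes "vcong p u v"
  shows "vcong p (u v* M) (v v* M)"
proof -
  have "(u v* M) $ i - (v v* M) $ i = (u $ 1 - v $ 1) * M $ 1 $ i + (u $ 2 - v $ 2) * M $ 2 $ i" for i
    by (simp add: vector_matrix_mult_def sum_2 algebra_simps)
  then show ?thesis
    using assms by (simp add: vcong_def)
qed

text \<open>Multiplying by the adjugate, as in Cramer's rule, yields \<open>det M\<close> times the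
  difference, and \<open>det M\<close> is a unit modulo \<open>p\<close>.\<close>

lemma vcong_vector_matrix_mult_cancel:
  fixes M :: "int^2^2"
  assumes "coprime (det M) (int p)" and c: "vcong p (u v* M) (v v* M)"
  shows "vcong p u v"
proof -
  define y where "y i = (u v* M) $ i - (v v* M) $ i" for i
  have y: "int p dvd y i" for i
    using c by (simp add: vcong_def y_def)
  have "det M * (u $ 1 - v $ 1) = y 1 * M $ 2 $ 2 - y 2 * M $ 2 $ 1"
    "det M * (u $ 2 - v $ 2) = y 2 * M $ 1 $ 1 - y 1 * M $ 1 $ 2"
    by (simp_all add: y_def vector_matrix_mult_def sum_2 det_2 algebra_simps)
  then have "int p dvd det M * (u $ 1 - v $ 1)" "int p dvd det M * (u $ 2 - v $ 2)"
    using y by simp_all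
  then have "int p dvd u $ 1 - v $ 1" "int p dvd u $ 2 - v $ 2"
    using assms(1) by (simp_all add: coprime_dvd_mult_right_iff coprime_commute)
  then show ?thesis
    by (simp add: vcong_def forall_2)
qed

locale invertible_mod =
  fixes p :: nat and M :: "int^2^2"
  assumes p_pos: "p > 0" and coprime_det: "coprime (det M) (int p)"
begin

abbreviation "T \<equiv> \<lambda>v. v v* M"

lemma T_pow_diff: "(T ^^ n) (u - v) = (T ^^ n) u - (T ^^ n) v"
  by (induction n arbitrary: u v) (simp_all add: vector_matrix_mult_diff_distrib)

lemma T_pow_minus: "(T ^^ n) (- v) = - (T ^^ n) v"
  using T_pow_diff[of n 0 v] T_pow_diff[of n 0 0] by simp

lemma vcong_T_pow: "vcong p u v \<Longrightarrow> vcong p ((T ^^ n) u) ((T ^^ n) v)"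
  by (induction n) (simp_all add: vcong_vector_matrix_mult)

lemma vcong_T_pow_cancel: "vcong p ((T ^^ n) u) ((T ^^ n) v) \<Longrightarrow> vcong p u v"
  by (induction n) (simp_all add: vcong_vector_matrix_mult_cancel[OF coprime_det])

lemma T_pow_nonzero: "\<not> vcong p v 0 \<Longrightarrow> \<not> vcong p ((T ^^ n) v) 0"
  using vcong_T_pow_cancel[of n v 0] T_pow_diff[of n 0 0] by auto

text \<open>Pigeonhole: the \<open>p\<^sup>2\<close> powers with exponents below
  \<open>p\<^sup>2\<close> take values in only \<open>p\<^sup>2 - 1\<close> nonzero classes.
  Invertibility modulo \<open>p\<close> cancels the common power.\<close>

lemma ex_period:
  assumes "\<not> vcong p v 0"
  obtains q where "1 \<le> q" "q \<le> p\<^sup>2 - 1" "vcong p ((T ^^ q) v) v"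
proof -
  define f where "f n = ((T ^^ n) v $ 1 mod int p, (T ^^ n) v $ 2 mod int p)" for n
  let ?R = "{0..<int p} \<times> {0..<int p} - {(0, 0)}"
  have "f ` {..<p\<^sup>2} \<subseteq> ?R"
    using T_pow_nonzero[OF assms] p_pos
    by (auto simp: f_def vcong_def forall_2 mod_eq_0_iff_dvd)
  moreover have "card ?R < p\<^sup>2"
    using p_pos by (subst card_Diff_subset) (auto simp: card_cartesian_product power2_eq_square)
  ultimately have "\<not> inj_on f {..<p\<^sup>2}"
    using card_inj_on_le[of f "{..<p\<^sup>2}" ?R] by auto
  then obtain m n where mn: "m < p\<^sup>2" "n < p\<^sup>2" "m < n" "f m = f n"
    unfolding inj_on_def by (metis lessThan_iff nat_neq_iff)
  have "vcong p ((T ^^ m) ((T ^^ (n - m)) v)) ((T ^^ m) v)"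
  proof -
    have "(T ^^ m) ((T ^^ (n - m)) v) = (T ^^ n) v"
      using mn(3) by (metis comp_apply funpow_add le_add_diff_inverse less_imp_le)
    then show ?thesis
      using mn(4) by (simp add: f_def vcong_def forall_2 mod_eq_dvd_iff dvd_diff_commute)
  qed
  then show thesis
    using that[of "n - m"] vcong_T_pow_cancel mn by auto
qed

lemma vcong_T_pow_mult:
  assumes "vcong p ((T ^^ q) v) v"
  shows "vcong p ((T ^^ (n + k * q)) v) ((T ^^ n) v)"
proof (induction k)
  case (Suc k)
  have "n + Suc k * q = (n + k * q) + q"
    by simp
  then have "(T ^^ (n + Suc k * q)) v = (T ^^ (n + k * q)) ((T ^^ q) v)"
    by (simp only: funpow_add comp_apply)
  then show ?case
    using vcong_trans[OF vcong_T_pow[OF assms, of "n + k * q"] Suc] by simp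
qed simp

lemma T_pow_bounded_exponent:
  assumes "\<not> vcong p v 0" "1 \<le> j"
  obtains j' where "1 \<le> j'" "j' \<le> p\<^sup>2 - 1" "vcong p ((T ^^ j) v) ((T ^^ j') v)"
proof -
  obtain q where q: "1 \<le> q" "q \<le> p\<^sup>2 - 1" "vcong p ((T ^^ q) v) v"
    using ex_period[OF assms(1)] .
  \<comment> \<open>Exponents start at 1, so \<open>j - 1\<close> is reduced modulo the period and
    shifted back into the range from 1 to \<open>q\<close>.\<close>
  define j' where "j' = Suc ((j - 1) mod q)"
  have "j = j' + (j - 1) div q * q"
    using assms(2) by (simp add: j'_def)
  then have "vcong p ((T ^^ j) v) ((T ^^ j') v)"
    using vcong_T_pow_mult[OF q(3)] by metis
  moreover have "j' \<le> q"
    using q(1) by (simp add: j'_def Suc_le_eq)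
  ultimately show thesis
    using that[of j'] q(2) by (simp add: j'_def)
qed

text \<open>The factorial is a multiple of every period, so one exponent serves all nonzero
  classes.\<close>

lemma vcong_T_pow_fact:
  assumes "\<not> vcong p v 0"
  shows "vcong p ((T ^^ (k * fact (p\<^sup>2 - 1))) v) v"
proof -
  obtain q where q: "1 \<le> q" "q \<le> p\<^sup>2 - 1" "vcong p ((T ^^ q) v) v"
    using ex_period[OF assms(1)] .
  then have "q dvd fact (p\<^sup>2 - 1)"
    by (intro dvd_fact) auto
  then obtain m where "fact (p\<^sup>2 - 1) = q * m" ..
  then have "k * fact (p\<^sup>2 - 1) = 0 + k * m * q"
    by simp
  then show ?thesis
    using vcong_T_pow_mult[OF q(3), of 0 "k * m"] by (simp only: funpow_0)
qed

end

section \<open>Units modulo 2 and 3\<close>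

lemma residues_mod_2_3:
  assumes "p \<in> {2, 3::nat}"
  shows "int p dvd c \<or> int p dvd c - 1 \<or> int p dvd c + 1"
proof -
  have "(2::int) dvd c \<or> 2 dvd c - 1" "(3::int) dvd c \<or> 3 dvd c - 1 \<or> 3 dvd c + 1"
    by presburger+
  then show ?thesis
    using assms by auto
qed

lemma square_mod_2_3:
  assumes "p \<in> {2, 3::nat}" "\<not> int p dvd c"
  shows "int p dvd c * c - 1"
proof -
  have "c * c - 1 = (c - 1) * (c + 1)"
    by (simp add: algebra_simps)
  then show ?thesis
    using residues_mod_2_3[OF assms(1), of c] assms(2) by auto
qed

text \<open>A vanishing determinant makes \<open>u\<close> a multiple of \<open>v\<close> modulo
  \<open>p\<close>, and for these \<open>p\<close> the only scalars are 0 and \<plusminus>1.\<close>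

lemma vcong_multiple_if_parallel:
  fixes u v :: "int^2"
  assumes p: "p \<in> {2, 3}" and v: "\<not> vcong p v 0"
    and par: "int p dvd v $ 1 * u $ 2 - v $ 2 * u $ 1"
  shows "vcong p u 0 \<or> vcong p u v \<or> vcong p u (- v)"
proof -
  obtain i j where ij: "(i = 1 \<and> j = 2) \<or> (i = 2 \<and> j = (1::2))" "\<not> int p dvd v $ i"
    using v by (auto simp: vcong_def forall_2)
  \<comment> \<open>This is the quotient of \<open>u $ i\<close> by \<open>v $ i\<close>, as a unit
    modulo 2 or 3 is its own inverse.\<close>
  define c where "c = u $ i * v $ i"
  have sq: "int p dvd v $ i * v $ i - 1"
    using square_mod_2_3[OF p ij(2)] .
  have parij: "int p dvd v $ i * u $ j - v $ j * u $ i"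
    using ij(1) par by (auto simp: dvd_diff_commute)
  have 1: "int p dvd u $ i - c * v $ i"
  proof -
    have "u $ i - c * v $ i = - u $ i * (v $ i * v $ i - 1)"
      by (simp add: c_def algebra_simps)
    then show ?thesis using sq by (metis dvd_mult)
  qed
  have 2: "int p dvd u $ j - c * v $ j"
  proof -
    have "u $ j - c * v $ j = v $ i * (v $ i * u $ j - v $ j * u $ i) - u $ j * (v $ i * v $ i - 1)"
      by (simp add: c_def algebra_simps)
    then show ?thesis using sq parij by (metis dvd_mult dvd_diff)
  qed
  have multiple: "int p dvd u $ k - c * v $ k" for k
    using 1 2 ij(1) exhaust_2[of k] by auto
  have shift: "int p dvd u $ k - e * v $ k" if "int p dvd c - e" for e k
  proof -
    have "u $ k - e * v $ k = (u $ k - c * v $ k) + (c - e) * v $ k"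
      by (simp add: algebra_simps)
    then show ?thesis using multiple that by (metis dvd_add dvd_mult2)
  qed
  consider "int p dvd c - 0" | "int p dvd c - 1" | "int p dvd c - (- 1)"
    using residues_mod_2_3[OF p, of c] by auto
  then show ?thesis
    using shift unfolding vcong_def by cases fastforce+
qed

section \<open>Zeros on the grid and their orbits\<close>

text \<open>\<open>W\<close> models the numerators of the zeros of the mask: periodicity makes it a
  union of classes modulo \<open>p\<close>, conjugation makes it symmetric.\<close>

locale grid_zeros = invertible_mod +
  fixes W :: "(int^2) set"
  assumes p_2_3: "p \<in> {2, 3}"
    and W_vcong: "w \<in> W \<Longrightarrow> vcong p w w' \<Longrightarrow> w' \<in> W"
    and W_minus: "w \<in> W \<Longrightarrow> - w \<in> W"
    and W_nonzero: "0 \<notin> W" and W_ne: "W \<noteq> {}"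
begin

text \<open>Numerators of the zeros of the Fourier transform, with exact powers of \<open>T\<close>;
  unlike \<open>W\<close>, this need not be a union of classes modulo \<open>p\<close>.\<close>

definition orbit_zeros :: "(int^2) set" where
  "orbit_zeros = {(T ^^ j) w | j w. 1 \<le> j \<and> w \<in> W}"

lemma W_not_vcong_0: "w \<in> W \<Longrightarrow> \<not> vcong p w 0"
  using W_vcong W_nonzero by blast

lemma orbit_zeros_not_vcong_0: "z \<in> orbit_zeros \<Longrightarrow> \<not> vcong p z 0"
  by (auto simp: orbit_zeros_def T_pow_nonzero W_not_vcong_0)

lemma mult_W:
  assumes "w \<in> W" "\<not> int p dvd k"
  shows "k *s w \<in> W"
proof -
  have "(vcong p w (k *s w)) \<or> (vcong p (- w) (k *s w))"
  proof -
    have "w $ i - (k *s w) $ i = - (k - 1) * w $ i" "(- w) $ i - (k *s w) $ i = - (k + 1) * w $ i" for i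
      by (simp_all add: algebra_simps)
    then show ?thesis
      using residues_mod_2_3[OF p_2_3, of k] assms(2) unfolding vcong_def
      by (metis dvd_minus_iff dvd_mult2)
  qed
  then show ?thesis
    using W_vcong W_minus assms(1) by blast
qed

text \<open>Periodicity extends the avoidance of \<open>v\<close> to all exponents. A zero parallel
  to \<open>v\<close> would be congruent to 0, \<open>v\<close> or \<open>- v\<close>, and the last
  case reduces to \<open>v\<close> by the symmetry of \<open>W\<close>.\<close>

lemma not_orbit_zeros_if_avoided:
  assumes v: "\<not> vcong p v 0"
    and av: "\<And>j w. 1 \<le> j \<Longrightarrow> j \<le> p\<^sup>2 - 1 \<Longrightarrow> w \<in> W \<Longrightarrow> \<not> vcong p v ((T ^^ j) w)"
    and par: "int p dvd v $ 1 * u $ 2 - v $ 2 * u $ 1"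
  shows "u \<notin> orbit_zeros"
proof
  assume "u \<in> orbit_zeros"
  then obtain j w where u: "u = (T ^^ j) w" "1 \<le> j" "w \<in> W"
    by (auto simp: orbit_zeros_def)
  have *: "\<not> vcong p v ((T ^^ j) w')" if w': "w' \<in> W" for w'
  proof
    assume vj: "vcong p v ((T ^^ j) w')"
    obtain j' where "1 \<le> j'" "j' \<le> p\<^sup>2 - 1" "vcong p ((T ^^ j) w') ((T ^^ j') w')"
      using T_pow_bounded_exponent[OF W_not_vcong_0[OF w'] u(2)] .
    then show False
      using av[OF _ _ w'] vcong_trans[OF vj] by blast
  qed
  consider "vcong p u 0" | "vcong p u v" | "vcong p u (- v)"
    using vcong_multiple_if_parallel[OF p_2_3 v par] by blast
  then show False
  proof cases
    case 1
    then show False using \<open>u \<in> orbit_zeros\<close> orbit_zeros_not_vcong_0 by blast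
  next
    case 2
    then show False using *[OF u(3)] u(1) vcong_sym by blast
  next
    case 3
    then have "vcong p v (- u)"
      using vcong_minus vcong_sym by fastforce
    then show False using *[OF W_minus[OF u(3)]] u(1) by (simp add: T_pow_minus)
  qed
qed

text \<open>The covering holds only up to congruence. Pulling \<open>j\<close> powers out of
  \<open>N\<close> leaves a vector congruent to \<open>(T ^^ N) w\<close>, hence to
  \<open>w\<close>, hence in \<open>W\<close>; so membership becomes exact.\<close>

lemma orbit_zeros_if_covered:
  assumes cov: "\<And>v. \<not> vcong p v 0 \<Longrightarrow> \<exists>j w. 1 \<le> j \<and> j \<le> p\<^sup>2 - 1 \<and> w \<in> W \<and> vcong p v ((T ^^ j) w)"
    and v: "\<not> vcong p v 0"
  shows "(T ^^ (p\<^sup>2 * fact (p\<^sup>2 - 1))) v \<in> orbit_zeros"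
proof -
  define N where "N = p\<^sup>2 * fact (p\<^sup>2 - 1)"
  obtain j w where jw: "1 \<le> j" "j \<le> p\<^sup>2 - 1" "w \<in> W" "vcong p v ((T ^^ j) w)"
    using cov[OF v] by blast
  \<comment> \<open>The factor \<open>p\<^sup>2\<close> in \<open>N\<close> ensures
    \<open>j \<le> N\<close>, so the natural subtraction \<open>N - j\<close> is genuine.\<close>
  have "p\<^sup>2 * 1 \<le> N"
    unfolding N_def by (intro mult_le_mono2) simp
  then have jN: "j \<le> N"
    using jw(2) by linarith
  have "vcong p ((T ^^ (N - j)) v) ((T ^^ (N - j)) ((T ^^ j) w))"
    by (rule vcong_T_pow[OF jw(4)])
  also have "(T ^^ (N - j)) ((T ^^ j) w) = (T ^^ N) w"
    using jN by (metis comp_apply funpow_add le_add_diff_inverse2)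
  finally have "vcong p ((T ^^ (N - j)) v) ((T ^^ N) w)" .
  then have "vcong p ((T ^^ (N - j)) v) w"
    using vcong_T_pow_fact[OF W_not_vcong_0[OF jw(3)], of "p\<^sup>2", folded N_def] by (rule vcong_trans)
  then have "(T ^^ (N - j)) v \<in> W"
    using W_vcong jw(3) vcong_sym by blast
  moreover have "(T ^^ N) v = (T ^^ j) ((T ^^ (N - j)) v)"
    using jN by (metis comp_apply funpow_add le_add_diff_inverse)
  ultimately show ?thesis
    using jw(1) unfolding orbit_zeros_def N_def by blast
qed

end

section \<open>Maximal orthogonal sets\<close>

text \<open>An orthogonal set that attains the upper bound is automatically maximal, since no
  orthogonal superset can be larger.\<close>

lemma n_star_eqI:
  assumes upper: "\<And>\<Lambda>. orthogonal_exponentials \<mu> \<Lambda> \<Longrightarrow> finite \<Lambda> \<and> card \<Lambda> \<le> n"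
    and orth: "orthogonal_exponentials \<mu> \<Lambda>" and card: "card \<Lambda> = n"
  shows "n_star \<mu> = enat n"
  unfolding n_star_def
proof (rule antisym)
  show "Sup {ecard \<Lambda> |\<Lambda>. maximal_orthogonal_exponentials \<mu> \<Lambda>} \<le> enat n"
    using upper by (intro Sup_least) (auto simp: maximal_orthogonal_exponentials_def ecard_def)
  have "maximal_orthogonal_exponentials \<mu> \<Lambda>"
    unfolding maximal_orthogonal_exponentials_def
    using orth upper card card_seteq by metis
  moreover have "ecard \<Lambda> = enat n"
    using upper[OF orth] card by (simp add: ecard_def)
  ultimately show "enat n \<le> Sup {ecard \<Lambda> |\<Lambda>. maximal_orthogonal_exponentials \<mu> \<Lambda>}"
    by (intro Sup_upper) force
qed

section \<open>Grid points and their classes in the torus\<close>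

lemma of_int_vec_0 [simp]: "of_int_vec 0 = 0"
  by (simp add: of_int_vec_def vec_eq_iff)

lemma of_int_vec_add: "of_int_vec (a + b) = of_int_vec a + of_int_vec b"
  by (simp add: of_int_vec_def vec_eq_iff)

lemma of_int_vec_diff: "of_int_vec (a - b) = of_int_vec a - of_int_vec b"
  by (simp add: of_int_vec_def vec_eq_iff)

lemma of_int_vec_minus: "of_int_vec (- a) = - of_int_vec a"
  by (simp add: of_int_vec_def vec_eq_iff)

lemma of_int_vec_inject: "of_int_vec a = of_int_vec b \<longleftrightarrow> a = b"
  by (simp add: of_int_vec_def vec_eq_iff)

definition grid_point :: "nat \<Rightarrow> int^2 \<Rightarrow> real^2" where
  "grid_point p l = (1 / real p) *\<^sub>R of_int_vec l"

lemma grid_point_diff: "grid_point p a - grid_point p b = grid_point p (a - b)"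
  by (simp add: grid_point_def of_int_vec_diff scaleR_diff_right)

lemma grid_point_inject: "p > 0 \<Longrightarrow> grid_point p a = grid_point p b \<longleftrightarrow> a = b"
  by (simp add: grid_point_def of_int_vec_inject)

lemma grid_point_iterate:
  "((\<lambda>l. l v* of_int_mat M) ^^ j) (grid_point p v) = grid_point p (((\<lambda>v. v v* M) ^^ j) v)"
proof (induction j)
  case (Suc j)
  have "grid_point p v v* of_int_mat M = grid_point p (v v* M)" for v
    by (simp add: grid_point_def vec_eq_iff vector_matrix_mult_def of_int_vec_def sum_2 forall_2 add_divide_distrib)
  then show ?case
    using Suc by simp
qed simp

lemma torus_proj_eq_iff: "torus_proj x = torus_proj y \<longleftrightarrow> (\<exists>k. x - y = of_int_vec k)"
proof
  assume "torus_proj x = torus_proj y"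
  moreover have "x + of_int_vec 0 \<in> torus_proj x"
    unfolding torus_proj_def by blast
  ultimately have "x \<in> torus_proj y"
    by simp
  then show "\<exists>k. x - y = of_int_vec k"
    by (auto simp: torus_proj_def)
next
  assume "\<exists>k. x - y = of_int_vec k"
  then obtain k where k: "x = y + of_int_vec k"
    by (metis add.commute diff_add_cancel)
  have "x + of_int_vec m \<in> torus_proj y" for m
    unfolding torus_proj_def k by (intro range_eqI[of _ _ "k + m"]) (simp add: of_int_vec_add add.assoc)
  moreover have "y + of_int_vec m \<in> torus_proj x" for m
    unfolding torus_proj_def k by (intro range_eqI[of _ _ "m - k"]) (simp add: of_int_vec_diff)
  ultimately show "torus_proj x = torus_proj y"
    unfolding torus_proj_def by blast
qed

lemma torus_proj_grid_point_eq_iff: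
  assumes "p > 0"
  shows "torus_proj (grid_point p u) = torus_proj (grid_point p v) \<longleftrightarrow> vcong p u v"
proof -
  have "grid_point p u - grid_point p v = of_int_vec k \<longleftrightarrow> u - v = int p *s k" for k
  proof -
    have "grid_point p (u - v) $ i = of_int_vec k $ i \<longleftrightarrow> (u - v) $ i = (int p *s k) $ i" for i
    proof -
      have "grid_point p (u - v) $ i = of_int_vec k $ i \<longleftrightarrow> real_of_int ((u - v) $ i) = real_of_int (int p * k $ i)"
        using assms by (simp add: grid_point_def of_int_vec_def field_simps)
      then show ?thesis
        unfolding of_int_eq_iff by simp
    qed
    then show ?thesis
      unfolding grid_point_diff by (simp only: vec_eq_iff)
  qed
  moreover have "(\<exists>k. u - v = int p *s k) \<longleftrightarrow> vcong p u v"
  proof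
    assume "vcong p u v"
    then have "u - v = int p *s (\<chi> i. (u $ i - v $ i) div int p)"
      by (simp add: vcong_def vec_eq_iff)
    then show "\<exists>k. u - v = int p *s k" ..
  next
    assume "\<exists>k. u - v = int p *s k"
    then obtain k where "u - v = int p *s k" ..
    then have "u $ i - v $ i = int p * k $ i" for i
      by (metis vector_minus_component vector_smult_component)
    then show "vcong p u v"
      by (simp add: vcong_def)
  qed
  ultimately show ?thesis
    by (simp add: torus_proj_eq_iff)
qed

lemma mask_add_of_int_vec: "mask D (x + of_int_vec k) = mask D x"
proof -
  have "expo (of_int_vec d) (of_int_vec k) = 1" for d k :: "int^2"
  proof -
    obtain m where "of_int_vec d \<bullet> of_int_vec k = real_of_int m"
    proof
      show "of_int_vec d \<bullet> of_int_vec k = real_of_int (\<Sum>i\<in>UNIV. d $ i * k $ i)"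
        by (simp add: inner_vec_def of_int_vec_def)
    qed
    then show ?thesis
      using exp_integer_2pi[of "of_int m"] by (simp add: expo_def mult_ac)
  qed
  then show ?thesis
    by (simp add: mask_def expo_add_right)
qed

lemma mask_uminus: "mask D (- x) = cnj (mask D x)"
  by (simp add: mask_def expo_def exp_cnj)

section \<open>Counting by differences\<close>

text \<open>Relative to a base point all elements have integer numerators. The label
  \<open>\<kappa>\<close> is injective on them, because equal labels forbid a difference in
  \<open>Z\<close>.\<close>

lemma card_le_if_separated_differences:
  assumes diff: "\<And>l l'. l \<in> \<Lambda> \<Longrightarrow> l' \<in> \<Lambda> \<Longrightarrow> l \<noteq> l' \<Longrightarrow> l - l' \<in> grid_point p ` Z"
    and p: "p > 0"
    and \<kappa>: "\<And>a. \<kappa> a \<in> K" "finite K" "\<And>a b. \<kappa> a = \<kappa> b \<Longrightarrow> a - b \<notin> Z"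
  shows "finite \<Lambda> \<and> card \<Lambda> \<le> card K"
proof (cases "\<Lambda> = {}")
  case False
  then obtain l0 where l0: "l0 \<in> \<Lambda>" by blast
  have "\<exists>a. l = l0 + grid_point p a" if "l \<in> \<Lambda>" for l
  proof (cases "l = l0")
    case True
    then have "l = l0 + grid_point p 0"
      by (simp add: grid_point_def of_int_vec_def vec_eq_iff)
    then show ?thesis ..
  next
    case False
    then show ?thesis
      using diff[OF that l0 False] by (metis add.commute diff_add_cancel imageE)
  qed
  then obtain a where a: "\<And>l. l \<in> \<Lambda> \<Longrightarrow> l = l0 + grid_point p (a l)"
    by metis
  have "inj_on (\<lambda>l. \<kappa> (a l)) \<Lambda>"
  proof (rule inj_onI, rule ccontr)
    fix l l' assume l: "l \<in> \<Lambda>" "l' \<in> \<Lambda>" "\<kappa> (a l) = \<kappa> (a l')" "l \<noteq> l'"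
    have "l - l' = grid_point p (a l - a l')"
      using a[OF l(1)] a[OF l(2)] by (metis add_diff_cancel_left grid_point_diff)
    then have "a l - a l' \<in> Z"
      using diff[OF l(1,2,4)] grid_point_inject[OF p] by auto
    then show False
      using \<kappa>(3)[OF l(3)] by blast
  qed
  then show ?thesis
    using \<kappa>(1,2) by (intro conjI inj_on_finite[of _ \<Lambda> K] card_inj_on_le[of _ \<Lambda> K]) auto
qed simp

lemma card_grid_point_image:
  assumes "p > 0" and Z: "0 \<notin> Z"
    and diff: "\<And>i j. i \<in> I \<Longrightarrow> j \<in> I \<Longrightarrow> i \<noteq> j \<Longrightarrow> a i - a j \<in> Z"
  shows "card ((\<lambda>i. grid_point p (a i)) ` I) = card I"
proof (rule card_image, rule inj_onI, rule ccontr)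
  fix i j assume "i \<in> I" "j \<in> I" "grid_point p (a i) = grid_point p (a j)" "i \<noteq> j"
  then show False
    using diff[of i j] Z assms(1) by (simp add: grid_point_inject)
qed

theorem theorem1p4:
  fixes p :: nat and D :: "(int ^ 2) set" and M :: "int ^ 2 ^ 2"
  assumes "p \<in> {2, 3}"
    and "finite D"
    and "mask_zeros D \<noteq> {}"
    and "mask_zeros D \<subseteq> E_grid0 p"
    and "expanding (of_int_mat M)"
    and "gcd (det M) (int p) = 1"
  shows "(M \<in> matrix_class1 p D \<longrightarrow>
           n_star (self_affine_measure (of_int_mat M) (of_int_vec ` D)) = enat p) \<and>
         (M \<in> matrix_class2 p D \<longrightarrow>
           n_star (self_affine_measure (of_int_mat M) (of_int_vec ` D)) = enat (p\<^sup>2))"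
proof -
  have p: "p > 0" "p \<ge> 2" using assms(1) by auto
  \<comment> \<open>The mask of an empty digit set is 0 everywhere, in particular at the origin,
    which \<open>E_grid0\<close> omits.\<close>
  have D_ne: "D \<noteq> {}"
  proof
    assume "D = {}"
    then have "0 \<in> mask_zeros D"
      by (simp add: mask_zeros_def mask_def)
    then show False
      using assms(4) by (auto simp: E_grid0_def)
  qed
  have card_D: "card D > 0"
    using assms(2) D_ne by (simp add: card_gt_0_iff)
  have det: "det (of_int_mat M :: real^2^2) = of_int (det M)"
    by (simp add: det_2)
  have "det M \<noteq> 0"
    using assms(6) p by auto
  then have det_nz: "det (of_int_mat M :: real^2^2) \<noteq> 0"
    unfolding det by simp
  interpret ifs: contracting_ifs "of_int_mat M" "of_int_vec ` D"
    using det_nz assms(2,5) D_ne by unfold_locales (auto intro: expanding_summable_inverse_iterates)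

  define W where "W = {l. mask D (grid_point p l) = 0}"
  define frac_vec where "frac_vec x = (\<chi> i. frac (x $ i))" for x :: "real^2"
  define floor_vec where "floor_vec x = (\<chi> i. \<lfloor>x $ i\<rfloor>)" for x :: "real^2"
  have frac_floor: "x = frac_vec x + of_int_vec (floor_vec x)" for x
    by (simp add: vec_eq_iff frac_vec_def floor_vec_def of_int_vec_def frac_def)
  have mask_frac: "mask D (frac_vec x) = mask D x" for x
    using frac_floor[of x] mask_add_of_int_vec by metis
  have torus_frac: "torus_proj (frac_vec x) = torus_proj x" for x
    using frac_floor[of x] torus_proj_eq_iff by (metis add_diff_cancel_left')
  have frac_zero: "frac_vec x \<in> mask_zeros D" if "mask D x = 0" for x
    using that by (simp add: mask_zeros_def mask_frac) (simp add: frac_vec_def frac_lt_1)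
  have E_grid: "\<exists>l. x = grid_point p l" if "x \<in> E_grid p" for x
    using that by (auto simp: E_grid_def grid_point_def)
  \<comment> \<open>The hypothesis covers zeros in the unit square only; periodicity puts the zeros
    of the whole plane on the grid.\<close>
  have mask_zero_grid: "\<exists>l\<in>W. x = grid_point p l" if "mask D x = 0" for x
  proof -
    have "frac_vec x \<in> E_grid p"
      using frac_zero[OF that] assms(4) by (auto simp: E_grid0_def)
    then obtain l where l: "frac_vec x = grid_point p l"
      using E_grid by blast
    have eq: "x = grid_point p (l + int p *s floor_vec x)"
      by (subst frac_floor, subst l)
        (use p in \<open>simp add: vec_eq_iff grid_point_def of_int_vec_def field_simps\<close>)
    show ?thesis
    proof
      show "x = grid_point p (l + int p *s floor_vec x)"
        by (fact eq)
      show "l + int p *s floor_vec x \<in> W"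
        using that by (simp add: W_def flip: eq)
    qed
  qed

  interpret grid_zeros p M W
  proof
    show "p > 0" "p \<in> {2, 3}" using p assms(1) by auto
    show "coprime (det M) (int p)"
      using assms(6) by (simp add: coprime_iff_gcd_eq_1)
    show "w' \<in> W" if "w \<in> W" and ww': "vcong p w w'" for w w'
    proof -
      obtain k where "grid_point p w' - grid_point p w = of_int_vec k"
        using torus_proj_grid_point_eq_iff[OF p(1), of w' w] vcong_sym[OF ww'] torus_proj_eq_iff by metis
      then have "grid_point p w' = grid_point p w + of_int_vec k"
        by (metis add.commute diff_add_cancel)
      then show ?thesis
        using that(1) by (simp add: W_def mask_add_of_int_vec)
    qed
    show "- w \<in> W" if "w \<in> W" for w
    proof -
      have "grid_point p (- w) = - grid_point p w"
        by (simp add: grid_point_def of_int_vec_minus)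
      then show ?thesis
        using that by (simp add: W_def mask_uminus)
    qed
    show "0 \<notin> W"
    proof
      assume "0 \<in> W"
      then have "frac_vec (grid_point p 0) \<in> E_grid0 p"
        using frac_zero assms(4) by (auto simp: W_def)
      then show False
        by (simp add: E_grid0_def frac_vec_def grid_point_def of_int_vec_def vec_eq_iff)
    qed
    show "W \<noteq> {}"
      using assms(3) mask_zero_grid by (fastforce simp: mask_zeros_def)
  qed

  have digit_sum: "ifs.digit_sum l = 0 \<longleftrightarrow> mask D l = 0" for l
  proof -
    have "ifs.digit_sum l = (\<Sum>d\<in>D. expo (of_int_vec d) l)"
      unfolding ifs.digit_sum_def
      by (subst sum.reindex) (auto simp: inj_on_def of_int_vec_inject)
    then show ?thesis
      using card_D by (simp add: mask_def)
  qed
  have char_fun: "ifs.char_fun l = 0 \<longleftrightarrow> l \<in> grid_point p ` orbit_zeros" for l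
  proof -
    have "(\<exists>l'. l = ((\<lambda>l. l v* of_int_mat M) ^^ j) l' \<and> ifs.digit_sum l' = 0)
        \<longleftrightarrow> (\<exists>w\<in>W. l = grid_point p ((T ^^ j) w))" for j
      unfolding digit_sum using mask_zero_grid W_def grid_point_iterate
      by (metis (mono_tags, lifting) mem_Collect_eq)
    then show ?thesis
      unfolding ifs.char_fun_eq_0_iff orbit_zeros_def by blast
  qed
  have orthogonal: "orthogonal_exponentials ifs.\<mu> \<Lambda> \<longleftrightarrow> countable \<Lambda> \<and>
      (\<forall>l\<in>\<Lambda>. \<forall>l'\<in>\<Lambda>. l \<noteq> l' \<longrightarrow> l - l' \<in> grid_point p ` orbit_zeros)" for \<Lambda>
    by (simp add: orthogonal_exponentials_def ifs.L2_inner_expo char_fun)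

  have grid_torus: "torus_proj ` E_grid0 p = (\<lambda>v. torus_proj (grid_point p v)) ` {v. \<not> vcong p v 0}"
  proof (intro equalityI subsetI)
    fix X assume "X \<in> torus_proj ` E_grid0 p"
    then obtain x where x: "X = torus_proj x" "x \<in> E_grid p" "x \<noteq> 0"
      by (auto simp: E_grid0_def)
    from x(2) obtain l where "x = grid_point p l" "\<forall>i. 0 \<le> l $ i \<and> l $ i \<le> int p - 1"
      unfolding E_grid_def grid_point_def by blast
    with x have l: "X = torus_proj (grid_point p l)" "grid_point p l \<noteq> 0"
        "\<forall>i. 0 \<le> l $ i \<and> l $ i \<le> int p - 1"
      by simp_all
    have "\<not> vcong p l 0"
    proof
      assume "vcong p l 0"
      then have "l $ i = 0" for i
        using l(3) zdvd_imp_le[of "int p" "l $ i"] by (auto simp: vcong_def) (smt (verit))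
      then have "l = 0" by (simp add: vec_eq_iff)
      then show False
        using l(2) by (simp add: grid_point_def of_int_vec_def vec_eq_iff)
    qed
    then show "X \<in> (\<lambda>v. torus_proj (grid_point p v)) ` {v. \<not> vcong p v 0}"
      using l(1) by blast
  next
    fix X assume "X \<in> (\<lambda>v. torus_proj (grid_point p v)) ` {v. \<not> vcong p v 0}"
    then obtain v where v: "X = torus_proj (grid_point p v)" "\<not> vcong p v 0" by blast
    define l where "l = (\<chi> i. v $ i mod int p)"
    have vl: "vcong p v l"
      by (simp add: vcong_def l_def flip: mod_eq_dvd_iff)
    then have "l \<noteq> 0" using v(2) by auto
    then have "grid_point p l \<in> E_grid0 p"
      using p grid_point_inject[OF p(1), of l 0]
      by (auto simp: E_grid0_def E_grid_def grid_point_def l_def of_int_vec_def vec_eq_iff zle_diff1_eq intro!: exI[of _ l])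
    moreover have "X = torus_proj (grid_point p l)"
      using v(1) torus_proj_grid_point_eq_iff[OF p(1)] vl by simp
    ultimately show "X \<in> torus_proj ` E_grid0 p" by blast
  qed
  have zero_orbit: "zero_orbit p D M =
      (\<Union>j\<in>{1..p\<^sup>2 - 1}. ((\<lambda>l. l v* of_int_mat M) ^^ j) ` mask_zeros D)"
    by (simp only: zero_orbit_def transpose_matrix_vector)
  have orbit_torus: "torus_proj ` zero_orbit p D M =
      {torus_proj (grid_point p ((T ^^ j) w)) | j w. 1 \<le> j \<and> j \<le> p\<^sup>2 - 1 \<and> w \<in> W}"
  proof (intro equalityI subsetI)
    fix X assume "X \<in> torus_proj ` zero_orbit p D M"
    then obtain j x where "1 \<le> j" "j \<le> p\<^sup>2 - 1" "mask D x = 0"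
      "X = torus_proj (((\<lambda>l. l v* of_int_mat M) ^^ j) x)"
      by (auto simp: zero_orbit mask_zeros_def)
    then show "X \<in> {torus_proj (grid_point p ((T ^^ j) w)) | j w. 1 \<le> j \<and> j \<le> p\<^sup>2 - 1 \<and> w \<in> W}"
      using mask_zero_grid[of x] grid_point_iterate by fastforce
  next
    fix X assume "X \<in> {torus_proj (grid_point p ((T ^^ j) w)) | j w. 1 \<le> j \<and> j \<le> p\<^sup>2 - 1 \<and> w \<in> W}"
    then obtain j w where jw: "1 \<le> j" "j \<le> p\<^sup>2 - 1" "w \<in> W" "X = torus_proj (grid_point p ((T ^^ j) w))"
      by blast
    \<comment> \<open>\<open>zero_orbit\<close> starts in the unit square, so \<open>w\<close> is
      replaced by the congruent numerator \<open>w'\<close> of its fractional part.\<close>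
    have zero: "frac_vec (grid_point p w) \<in> mask_zeros D"
      using frac_zero jw(3) by (simp add: W_def)
    then obtain w' where w': "frac_vec (grid_point p w) = grid_point p w'"
      using mask_zero_grid by (auto simp: mask_zeros_def)
    have "vcong p w' w"
      using torus_frac[of "grid_point p w"] torus_proj_grid_point_eq_iff[OF p(1)] by (simp add: w')
    then have "X = torus_proj (((\<lambda>l. l v* of_int_mat M) ^^ j) (grid_point p w'))"
      unfolding jw(4) grid_point_iterate torus_proj_grid_point_eq_iff[OF p(1)]
      using vcong_T_pow vcong_sym by blast
    moreover have "((\<lambda>l. l v* of_int_mat M) ^^ j) (grid_point p w') \<in> zero_orbit p D M"
      unfolding zero_orbit using zero[unfolded w'] jw(1,2) by (intro UN_I[of j] imageI) simp_all
    ultimately show "X \<in> torus_proj ` zero_orbit p D M"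
      by blast
  qed

  have class1: "n_star ifs.\<mu> = enat p" if "M \<in> matrix_class1 p D"
  proof -
    have "torus_proj ` zero_orbit p D M \<subset> torus_proj ` E_grid0 p"
      using that by (simp add: matrix_class1_def)
    then obtain v where v: "\<not> vcong p v 0"
        "torus_proj (grid_point p v) \<notin> torus_proj ` zero_orbit p D M"
      unfolding grid_torus by blast
    have avoid: "\<not> vcong p v ((T ^^ j) w)" if "1 \<le> j" "j \<le> p\<^sup>2 - 1" "w \<in> W" for j w
      using v(2) that torus_proj_grid_point_eq_iff[OF p(1)] unfolding orbit_torus by blast
    \<comment> \<open>The label names the parallel, modulo \<open>p\<close>, of the line spanned by
      the missed class \<open>v\<close>.\<close>
    let ?\<kappa> = "\<lambda>a. (v $ 1 * a $ 2 - v $ 2 * a $ 1) mod int p"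
    have "a - b \<notin> orbit_zeros" if "?\<kappa> a = ?\<kappa> b" for a b
    proof (rule not_orbit_zeros_if_avoided[OF v(1) avoid])
      show "int p dvd v $ 1 * (a - b) $ 2 - v $ 2 * (a - b) $ 1"
        using that by (simp add: mod_eq_dvd_iff algebra_simps)
    qed
    then have upper: "finite \<Lambda> \<and> card \<Lambda> \<le> card {0..<int p}" if "orthogonal_exponentials ifs.\<mu> \<Lambda>" for \<Lambda>
      using that p unfolding orthogonal
      by (intro card_le_if_separated_differences[of _ p orbit_zeros ?\<kappa>]) auto
    obtain w where w: "w \<in> W" using W_ne by blast
    \<comment> \<open>One application of \<open>T\<close> is made because exponents in
      \<open>orbit_zeros\<close> start at 1.\<close>
    define a where "a k = (T ^^ 1) (k *s w)" for k
    have a_diff: "a i - a j \<in> orbit_zeros" if "i \<in> {0..<int p}" "j \<in> {0..<int p}" "i \<noteq> j" for i j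
    proof -
      have "\<not> int p dvd i - j"
        using that zdvd_imp_le[of "int p" "i - j"] zdvd_imp_le[of "int p" "j - i"]
        by (metis atLeastLessThan_iff mod_eq_dvd_iff mod_pos_pos_trivial)
      then have "(i - j) *s w \<in> W"
        using mult_W[OF w] by blast
      moreover have "a i - a j = (T ^^ 1) ((i - j) *s w)"
        unfolding a_def T_pow_diff[symmetric] by (simp add: vector_sub_rdistrib)
      ultimately show ?thesis
        unfolding orbit_zeros_def by blast
    qed
    have Z0: "0 \<notin> orbit_zeros"
      using orbit_zeros_not_vcong_0 by force
    show ?thesis
    proof (rule n_star_eqI)
      show "orthogonal_exponentials ifs.\<mu> ((\<lambda>i. grid_point p (a i)) ` {0..<int p})"
        unfolding orthogonal by (auto simp: grid_point_diff intro!: imageI a_diff)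
      show "card ((\<lambda>i. grid_point p (a i)) ` {0..<int p}) = p"
        using card_grid_point_image[of p orbit_zeros "{0..<int p}" a, OF p(1) Z0 a_diff] by simp
    qed (use upper in simp)
  qed

  have class2: "n_star ifs.\<mu> = enat (p\<^sup>2)" if "M \<in> matrix_class2 p D"
  proof -
    have cl: "torus_proj ` zero_orbit p D M = torus_proj ` E_grid0 p"
      using that by (simp add: matrix_class2_def)
    have cover: "\<exists>j w. 1 \<le> j \<and> j \<le> p\<^sup>2 - 1 \<and> w \<in> W \<and> vcong p v ((T ^^ j) w)" if "\<not> vcong p v 0" for v
    proof -
      have "torus_proj (grid_point p v) \<in> torus_proj ` zero_orbit p D M"
        unfolding cl grid_torus using that by blast
      then show ?thesis
        unfolding orbit_torus using torus_proj_grid_point_eq_iff[OF p(1)] by blast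
    qed
    let ?I = "{0..<int p} \<times> {0..<int p}"
    have card_I: "card ?I = p\<^sup>2"
      by (simp add: power2_eq_square)
    let ?\<kappa> = "\<lambda>a::int^2. (a $ 1 mod int p, a $ 2 mod int p)"
    have "a - b \<notin> orbit_zeros" if "?\<kappa> a = ?\<kappa> b" for a b
      using that orbit_zeros_not_vcong_0[of "a - b"] by (auto simp: vcong_def forall_2 mod_eq_dvd_iff)
    then have upper: "finite \<Lambda> \<and> card \<Lambda> \<le> card ?I" if "orthogonal_exponentials ifs.\<mu> \<Lambda>" for \<Lambda>
      using that p unfolding orthogonal
      by (intro card_le_if_separated_differences[of _ p orbit_zeros ?\<kappa>]) auto
    define N where "N = p\<^sup>2 * fact (p\<^sup>2 - 1)"
    \<comment> \<open>Representatives of all \<open>p\<^sup>2\<close> classes are moved by the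
      exponent of \<open>orbit_zeros_if_covered\<close>, so their differences become exact
      zeros.\<close>
    define a where "a k = (T ^^ N) (vector [fst k, snd k])" for k :: "int \<times> int"
    have a_diff: "a i - a j \<in> orbit_zeros" if "i \<in> ?I" "j \<in> ?I" "i \<noteq> j" for i j
    proof -
      have "\<not> vcong p (vector [fst i, snd i] - vector [fst j, snd j]) (0 :: int^2)"
      proof
        assume "vcong p (vector [fst i, snd i] - vector [fst j, snd j]) (0 :: int^2)"
        then have "fst i mod int p = fst j mod int p" "snd i mod int p = snd j mod int p"
          by (simp_all add: vcong_def forall_2 mod_eq_dvd_iff)
        then show False
          using that by (auto simp: mod_pos_pos_trivial)
      qed
      then show ?thesis
        unfolding a_def T_pow_diff[symmetric] N_def using orbit_zeros_if_covered cover by blast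
    qed
    have Z0: "0 \<notin> orbit_zeros"
      using orbit_zeros_not_vcong_0 by force
    show ?thesis
    proof (rule n_star_eqI)
      show "orthogonal_exponentials ifs.\<mu> ((\<lambda>i. grid_point p (a i)) ` ?I)"
        unfolding orthogonal by (auto simp: grid_point_diff intro!: imageI a_diff)
      show "card ((\<lambda>i. grid_point p (a i)) ` ?I) = p\<^sup>2"
        using card_grid_point_image[of p orbit_zeros ?I a, OF p(1) Z0 a_diff] card_I by simp
    qed (use upper card_I in simp)
  qed
  show ?thesis
    using class1 class2 by blast
qed

end
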